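(* Let $\mathcal{D}$ be a probability distribution on $\mathbb{R}^d\times\{+1,-1\}$, let $(x_1,y_1),\ldots,(x_n,y_n)$ be drawn i.i.d. from $\mathcal{D}$, and let $\mathcal{H}$ be a class of functions $h:\mathbb{R}^d\to\mathbb{R}$. Let $c>0$ and suppose that $\sup_x|h(x)|\le c$ for all $h\in\mathcal{H}$. For $h\in\mathcal{H}$ and $\gamma>0$ let $$\mathcal{L}(h)=\mathbb{E}\big(\mathbf{1}(y\neq \mathrm{sign}(h(x)))\big),\qquad K_\gamma(h)=\frac{\#\{i: y_ih(x_i)\le\gamma\}}{n},\qquad J(h)=\frac1n\sum_{i=1}^n y_ih(x_i),$$ where the expectation in $\mathcal{L}(h)$ is over $(x,y)\sim\mathcal{D}$. Then for any $\zeta\in[0,1]$ and any $\delta\in(0,1)$, with probability at least $1-2\delta$ over the draw of the sample, $$\mathcal{L}(h)\le \zeta\,\big(1-J(h)/c\big)+(1-\zeta)\,K_\gamma(h)+\frac{4\,\mathcal{R}_n(\mathcal{H})}{\gamma}+\sqrt{\frac{\log\big(\log_2\frac{4c}{\gamma}\big)}{n}}+\sqrt{\frac{\log(1/\delta)}{2n}}$$ holds simultaneously for all $\gamma\in(0,c]$ and all $h\in\mathcal{H}$.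
   Context: $\mathcal{R}_n(\mathcal{H})$ is the (expected) Rademacher complexity of $\mathcal{H}$: $\mathcal{R}_n(\mathcal{H})=\mathbb{E}\big[\sup_{h\in\mathcal{H}}\frac1n\sum_{i=1}^n\epsilon_i h(x_i)\big]$, where $\epsilon_1,\ldots,\epsilon_n$ are i.i.d. uniform on $\{+1,-1\}$, independent of the $x_i$, and the expectation is over both the $x_i$ and the $\epsilon_i$. $\mathbf{1}(\cdot)$ is the indicator function and $\log$ is the natural logarithm. The usual measurability of the functions and suprema involved is assumed. *)

theory Defs
  imports "HOL-Probability.Probability"
begin

definition rademacher_signs :: "nat \<Rightarrow> (nat \<Rightarrow> real) measure" where
  "rademacher_signs n = PiM {..<n} (\<lambda>_. uniform_count_measure {-1, 1})"

definition rademacher_sup ::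
  "nat \<Rightarrow> ('z \<Rightarrow> real) set \<Rightarrow> (nat \<Rightarrow> 'z) \<times> (nat \<Rightarrow> real) \<Rightarrow> real" where
  "rademacher_sup n F = (\<lambda>(S, \<epsilon>). SUP f\<in>F. (1 / real n) * (\<Sum>i<n. \<epsilon> i * f (S i)))"

text \<open>The supremum and the Bochner integral are total functions on the reals; the value below is
  the intended one when \<open>F\<close> is nonempty and uniformly bounded and
  \<^const>\<open>rademacher_sup\<close> is measurable.\<close>

definition rademacher_complexity :: "nat \<Rightarrow> 'z measure \<Rightarrow> ('z \<Rightarrow> real) set \<Rightarrow> real" where
  "rademacher_complexity n P F =
     (\<integral>\<omega>. rademacher_sup n F \<omega> \<partial>(PiM {..<n} (\<lambda>_. P) \<Otimes>\<^sub>M rademacher_signs n))"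

text \<open>Since \<open>sgn 0 = 0\<close>, a point with \<open>h x = 0\<close> is misclassified whatever its label. For labels in
  \<open>{-1, 1}\<close> this error is at least the one obtained from either convention \<open>sign 0 = 1\<close> or
  \<open>sign 0 = -1\<close>, so an upper bound on it covers those conventions.\<close>

definition classification_error :: "('x \<times> real) measure \<Rightarrow> ('x \<Rightarrow> real) \<Rightarrow> real" where
  "classification_error D h = (\<integral>(x, y). of_bool (y \<noteq> sgn (h x)) \<partial>D)"

definition margin_error :: "nat \<Rightarrow> (nat \<Rightarrow> 'x \<times> real) \<Rightarrow> real \<Rightarrow> ('x \<Rightarrow> real) \<Rightarrow> real" where
  "margin_error n S \<gamma> h = real (card {i\<in>{..<n}. snd (S i) * h (fst (S i)) \<le> \<gamma>}) / real n"

definition average_margin :: "nat \<Rightarrow> (nat \<Rightarrow> 'x \<times> real) \<Rightarrow> ('x \<Rightarrow> real) \<Rightarrow> real" where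
  "average_margin n S h = (1 / real n) * (\<Sum>i<n. snd (S i) * h (fst (S i)))"

text \<open>The class of functions \<open>(x, y) \<mapsto> \<phi> (y h(x))\<close> for \<open>h\<close> in \<open>H\<close>.\<close>

definition margin_loss_class ::
  "(real \<Rightarrow> real) \<Rightarrow> ('x \<Rightarrow> real) set \<Rightarrow> ('x \<times> real \<Rightarrow> real) set" where
  "margin_loss_class \<phi> H = (\<lambda>h (x, y). \<phi> (y * h x)) ` H"

text \<open>Measurability of the empirical-process suprema: of the one that defines the Rademacher
  complexity of \<open>H\<close>, and of the analogous ones for the Lipschitz margin losses of \<open>H\<close>. Neither is
  automatic, as \<open>H\<close> may be uncountable; both hold for instance if every member of \<open>H\<close> is the
  pointwise limit of a sequence from a fixed countable set of measurable functions in \<open>H\<close>.\<close>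

definition measurable_suprema :: "nat \<Rightarrow> ('x::topological_space \<times> real) measure \<Rightarrow> ('x \<Rightarrow> real) set \<Rightarrow> bool" where
  "measurable_suprema n D H \<longleftrightarrow>
     rademacher_sup n H \<in> borel_measurable
       (PiM {..<n} (\<lambda>_. distr D borel fst) \<Otimes>\<^sub>M rademacher_signs n) \<and>
     (\<forall>\<phi> C. C-lipschitz_on UNIV \<phi> \<longrightarrow>
        rademacher_sup n (margin_loss_class \<phi> H) \<in> borel_measurable
          (PiM {..<n} (\<lambda>_. D) \<Otimes>\<^sub>M rademacher_signs n))"

end

theory Submission
  imports Defs "HOL-Probability.Hoeffding"
begin

text \<open>The loss \<open>\<zeta> ramp_c + (1 - \<zeta>) ramp_\<gamma>\<close> of the margin \<open>y h(x)\<close> takes values in \<open>[0, 1]\<close>, dominates the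
  classification error, is \<open>(1/\<gamma>)\<close>-Lipschitz, and its empirical mean is at most
  \<open>\<zeta> (1 - J(h)/c) + (1 - \<zeta>) K_\<gamma>(h)\<close>. For fixed \<open>\<gamma>\<close>, McDiarmid's inequality together with
  symmetrization bounds its expectation uniformly in \<open>h\<close>, and the contraction principle bounds the
  Rademacher complexity of the loss class by \<open>R_n(H)/\<gamma>\<close>. A union bound over the scales
  \<open>\<gamma> = c/2^k\<close>, \<open>k \<ge> 1\<close>, with deviations \<open>sqrt (ln k / n) + sqrt (ln (1/\<delta>) / (2 n))\<close> costs
  \<open>\<Sum>k. \<delta>/k\<^sup>2 \<le> 2 \<delta>\<close>. Rounding an arbitrary \<open>\<gamma>\<close> down to the next scale doubles the
  complexity term at most.\<close>

subsection \<open>McDiarmid's inequality\<close>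

text \<open>Induction on \<open>I\<close>, integrating out one coordinate \<open>i\<close> at a
  time. With the other coordinates fixed, \<open>f\<close> ranges over an interval of length
  \<open>c i\<close>, and Hoeffding's lemma contributes a factor with exponent
  \<open>l\<^sup>2 * (c i)\<^sup>2 / 8\<close>. The partial integral \<open>g\<close> inherits the
  bound \<open>B\<close> and the differences \<open>c j\<close>, so the induction hypothesis applies
  to it.\<close>

lemma mcdiarmid_mgf:
  fixes M :: "'i \<Rightarrow> 'a measure" and f :: "('i \<Rightarrow> 'a) \<Rightarrow> real"
  assumes M: "\<And>i. prob_space (M i)" and "finite I" and "l > 0"
    and "f \<in> borel_measurable (PiM I M)"
    and "\<And>x. x \<in> space (PiM I M) \<Longrightarrow> \<bar>f x\<bar> \<le> B"
    and "\<And>x i y. x \<in> space (PiM I M) \<Longrightarrow> i \<in> I \<Longrightarrow> y \<in> space (M i) \<Longrightarrow>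
           \<bar>f (x(i := y)) - f x\<bar> \<le> c i"
  shows "(\<integral>x. exp (l * (f x - (\<integral>x. f x \<partial>PiM I M))) \<partial>PiM I M)
           \<le> exp (l\<^sup>2 * (\<Sum>i\<in>I. (c i)\<^sup>2) / 8)"
  using assms(2,4-)
proof (induction I arbitrary: f rule: finite_induct)
  case empty
  interpret prob_space "PiM {} M" by (intro prob_space_PiM M)
  have [simp]: "prob {\<lambda>_. undefined} = 1"
    using prob_space by (simp add: space_PiM)
  have "(\<integral>x. f x \<partial>PiM {} M) = f (\<lambda>_. undefined)"
    by (subst Bochner_Integration.integral_cong[where g = "\<lambda>_. f (\<lambda>_. undefined)", OF refl])
       (auto simp: space_PiM)
  then have "(\<integral>x. exp (l * (f x - (\<integral>x. f x \<partial>PiM {} M))) \<partial>PiM {} M) = (\<integral>x. 1 \<partial>PiM {} M)"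
    by (intro Bochner_Integration.integral_cong) (auto simp: space_PiM)
  then show ?case by (simp add: prob_space)
next
  case (insert i I)
  interpret prob_space "M k" for k by (rule M)
  interpret PI: product_prob_space M UNIV by unfold_locales
  interpret I: prob_space "PiM I M" by (intro prob_space_PiM M)
  interpret J: prob_space "PiM (insert i I) M" by (intro prob_space_PiM M)
  have [measurable]: "f \<in> borel_measurable (PiM (insert i I) M)" by (rule insert.prems(1))
  have upd[measurable]: "(\<lambda>(x, y). x(i := y)) \<in> PiM I M \<Otimes>\<^sub>M M i \<rightarrow>\<^sub>M PiM (insert i I) M"
    by (rule measurable_add_dim)
  have upd': "(\<lambda>y. x(i := y)) \<in> M i \<rightarrow>\<^sub>M PiM (insert i I) M" if "x \<in> space (PiM I M)" for x
    using measurable_Pair2[OF upd that] by simp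
  have sp: "x(i := y) \<in> space (PiM (insert i I) M)"
    if "x \<in> space (PiM I M)" "y \<in> space (M i)" for x y
    using measurable_space[OF upd'[OF that(1)] that(2)] .
  have bd: "\<bar>f (x(i := y))\<bar> \<le> B" if "x \<in> space (PiM I M)" "y \<in> space (M i)" for x y
    using insert.prems(2) sp[OF that] by blast
  have m1: "(\<lambda>y. f (x(i := y))) \<in> borel_measurable (M i)" if "x \<in> space (PiM I M)" for x
    by (rule measurable_compose[OF upd'[OF that] insert.prems(1)])
  have int1: "integrable (M i) (\<lambda>y. f (x(i := y)))" if "x \<in> space (PiM I M)" for x
    by (rule integrable_const_bound[where B = B]) (use bd that m1 in auto)
  define g where "g x = (\<integral>y. f (x(i := y)) \<partial>M i)" for x
  have g_meas[measurable]: "g \<in> borel_measurable (PiM I M)"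
    unfolding g_def by measurable
  have g_bd: "\<bar>g x\<bar> \<le> B" if x: "x \<in> space (PiM I M)" for x
  proof -
    have "\<bar>g x\<bar> \<le> (\<integral>y. \<bar>f (x(i := y))\<bar> \<partial>M i)"
      unfolding g_def by (rule integral_abs_bound)
    also have "\<dots> \<le> B"
      by (rule integral_le_const) (use bd x int1 in auto)
    finally show ?thesis .
  qed
  have g_diff: "\<bar>g (x(j := y)) - g x\<bar> \<le> c j"
    if x: "x \<in> space (PiM I M)" and j: "j \<in> I" and y: "y \<in> space (M j)" for x j y
  proof -
    have xj: "x(j := y) \<in> space (PiM I M)"
      using x j y by (auto simp: space_PiM PiE_def extensional_def Pi_def)
    have ij: "i \<noteq> j" using insert.hyps j by auto
    have "g (x(j := y)) - g x = (\<integral>z. f (x(j := y, i := z)) - f (x(i := z)) \<partial>M i)"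
      unfolding g_def using int1[OF x] int1[OF xj] by simp
    also have "\<bar>\<dots>\<bar> \<le> (\<integral>z. \<bar>f (x(j := y, i := z)) - f (x(i := z))\<bar> \<partial>M i)"
      by (rule integral_abs_bound)
    also have "\<dots> \<le> c j"
    proof (rule integral_le_const)
      show "AE z in M i. \<bar>f (x(j := y, i := z)) - f (x(i := z))\<bar> \<le> c j"
      proof (rule AE_I2)
        fix z assume z: "z \<in> space (M i)"
        \<comment> \<open>The updates at \<open>i\<close> and \<open>j\<close> commute, so this is a
          difference of \<open>f\<close> in coordinate \<open>j\<close> at the point
          \<open>x(i := z)\<close>.\<close>
        show "\<bar>f (x(j := y, i := z)) - f (x(i := z))\<bar> \<le> c j"
          unfolding fun_upd_twist[OF ij, symmetric]
          using insert.prems(3)[OF sp[OF x z], of j y] j y by blast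
      qed
    qed (use int1[OF x] int1[OF xj] in auto)
    finally show ?thesis .
  qed
  have f_int: "integrable (PiM (insert i I) M) f"
    by (rule J.integrable_const_bound[where B = B]) (use insert.prems in auto)
  have Ef: "(\<integral>x. f x \<partial>PiM (insert i I) M) = (\<integral>x. g x \<partial>PiM I M)"
    unfolding g_def by (rule PI.product_integral_insert[OF insert.hyps f_int])
  define \<mu> where "\<mu> = (\<integral>x. g x \<partial>PiM I M)"
  have e_int: "integrable (PiM (insert i I) M) (\<lambda>x. exp (l * (f x - \<mu>)))"
  proof (rule J.integrable_const_bound[where B = "exp (l * (B - \<mu>))"])
    show "AE x in PiM (insert i I) M. norm (exp (l * (f x - \<mu>))) \<le> exp (l * (B - \<mu>))"
      using insert.prems(2) \<open>l > 0\<close> by (intro AE_I2) (auto intro!: mult_left_mono dest: abs_le_D1)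
  qed measurable
  have inner: "(\<integral>y. exp (l * (f (x(i := y)) - \<mu>)) \<partial>M i)
      \<le> exp (l * (g x - \<mu>)) * exp (l\<^sup>2 * (c i)\<^sup>2 / 8)" if x: "x \<in> space (PiM I M)" for x
  proof -
    \<comment> \<open>Any two values of this section of \<open>f\<close> differ by at most
      \<open>c i\<close>, so its infimum is the left end of an interval of length \<open>c i\<close>
      that contains all of them.\<close>
    define a where "a = (INF y\<in>space (M i). f (x(i := y)))"
    have bb: "bdd_below ((\<lambda>y. f (x(i := y))) ` space (M i))"
    proof (rule bdd_belowI2[of _ "-B"])
      show "- B \<le> f (x(i := y))" if "y \<in> space (M i)" for y
        using bd[OF x that] by linarith
    qed
    have "AE y in M i. f (x(i := y)) \<in> {a..a + c i}"
    proof (rule AE_I2)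
      fix y assume y: "y \<in> space (M i)"
      have "f (x(i := y)) - c i \<le> f (x(i := z))" if z: "z \<in> space (M i)" for z
      proof -
        have "\<bar>f (x(i := y)) - f (x(i := z))\<bar> \<le> c i"
          using insert.prems(3)[OF sp[OF x z] insertI1 y] by (simp only: fun_upd_upd)
        then show ?thesis by linarith
      qed
      then have "f (x(i := y)) - c i \<le> a"
        unfolding a_def by (intro cINF_greatest) (auto simp: not_empty)
      moreover have "a \<le> f (x(i := y))"
        unfolding a_def by (rule cINF_lower[OF bb y])
      ultimately show "f (x(i := y)) \<in> {a..a + c i}" by simp
    qed
    then interpret V: interval_bounded_random_variable "M i" "\<lambda>y. f (x(i := y))" a "a + c i"
      by unfold_locales (use m1[OF x] in auto)
    have "ennreal (\<integral>y. exp (l * (f (x(i := y)) - g x)) \<partial>M i)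
            = (\<integral>\<^sup>+y. exp (l * (f (x(i := y)) - g x)) \<partial>M i)"
    proof (rule nn_integral_eq_integral[symmetric])
      show "integrable (M i) (\<lambda>y. exp (l * (f (x(i := y)) - g x)))"
      proof (rule integrable_const_bound[where B = "exp (l * (B - g x))"])
        show "AE y in M i. norm (exp (l * (f (x(i := y)) - g x))) \<le> exp (l * (B - g x))"
          using bd[OF x] \<open>l > 0\<close> by (intro AE_I2) (auto intro!: mult_left_mono dest: abs_le_D1)
      qed (use m1[OF x] in measurable)
    qed auto
    also have "\<dots> \<le> ennreal (exp (l\<^sup>2 * (c i)\<^sup>2 / 8))"
      using V.Hoeffdings_lemma_nn_integral[OF \<open>l > 0\<close>] by (simp add: g_def)
    finally have "(\<integral>y. exp (l * (f (x(i := y)) - g x)) \<partial>M i) \<le> exp (l\<^sup>2 * (c i)\<^sup>2 / 8)"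
      by (subst (asm) ennreal_le_iff) auto
    moreover have "(\<integral>y. exp (l * (f (x(i := y)) - \<mu>)) \<partial>M i)
        = exp (l * (g x - \<mu>)) * (\<integral>y. exp (l * (f (x(i := y)) - g x)) \<partial>M i)"
      by (subst integral_mult_right_zero[symmetric]) (simp add: exp_add[symmetric] algebra_simps)
    ultimately show ?thesis by (simp add: mult_left_mono)
  qed
  have "(\<integral>x. exp (l * (f x - \<mu>)) \<partial>PiM (insert i I) M)
      = (\<integral>x. (\<integral>y. exp (l * (f (x(i := y)) - \<mu>)) \<partial>M i) \<partial>PiM I M)"
    by (rule PI.product_integral_insert[OF insert.hyps e_int])
  also have "\<dots> \<le> (\<integral>x. exp (l * (g x - \<mu>)) * exp (l\<^sup>2 * (c i)\<^sup>2 / 8) \<partial>PiM I M)"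
  proof (rule integral_mono')
    have "integrable (PiM I M) (\<lambda>x. exp (l * (g x - \<mu>)))"
    proof (rule I.integrable_const_bound[where B = "exp (l * (B - \<mu>))"])
      show "AE x in PiM I M. norm (exp (l * (g x - \<mu>))) \<le> exp (l * (B - \<mu>))"
        using g_bd \<open>l > 0\<close> by (intro AE_I2) (auto intro!: mult_left_mono dest: abs_le_D1)
    qed measurable
    then show "integrable (PiM I M) (\<lambda>x. exp (l * (g x - \<mu>)) * exp (l\<^sup>2 * (c i)\<^sup>2 / 8))" by simp
  qed (use inner in auto)
  also have "\<dots> = (\<integral>x. exp (l * (g x - \<mu>)) \<partial>PiM I M) * exp (l\<^sup>2 * (c i)\<^sup>2 / 8)" by simp
  also have "\<dots> \<le> exp (l\<^sup>2 * (\<Sum>i\<in>I. (c i)\<^sup>2) / 8) * exp (l\<^sup>2 * (c i)\<^sup>2 / 8)"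
    unfolding \<mu>_def by (intro mult_right_mono insert.IH g_meas g_bd g_diff) auto
  also have "\<dots> = exp (l\<^sup>2 * (\<Sum>j\<in>insert i I. (c j)\<^sup>2) / 8)"
    using insert.hyps by (simp add: exp_add[symmetric] algebra_simps add_divide_distrib)
  finally show ?case by (simp add: Ef \<mu>_def)
qed

text \<open>Chernoff's bound applied to the moment generating function above. It needs
  \<open>l > 0\<close>, hence the separate case \<open>t = 0\<close>, where the right-hand side is
  1.\<close>

theorem mcdiarmid:
  fixes M :: "'i \<Rightarrow> 'a measure" and f :: "('i \<Rightarrow> 'a) \<Rightarrow> real"
  assumes M: "\<And>i. prob_space (M i)" and I: "finite I" and t: "t \<ge> 0"
    and f[measurable]: "f \<in> borel_measurable (PiM I M)"
    and bd: "\<And>x. x \<in> space (PiM I M) \<Longrightarrow> \<bar>f x\<bar> \<le> B"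
    and diff: "\<And>x i y. x \<in> space (PiM I M) \<Longrightarrow> i \<in> I \<Longrightarrow> y \<in> space (M i) \<Longrightarrow>
           \<bar>f (x(i := y)) - f x\<bar> \<le> c i"
    and pos: "(\<Sum>i\<in>I. (c i)\<^sup>2) > 0"
  shows "measure (PiM I M) {x \<in> space (PiM I M). f x \<ge> (\<integral>x. f x \<partial>PiM I M) + t}
           \<le> exp (- 2 * t\<^sup>2 / (\<Sum>i\<in>I. (c i)\<^sup>2))"
proof (cases "t = 0")
  case True
  interpret prob_space "PiM I M" by (intro prob_space_PiM M)
  show ?thesis using True by simp
next
  case False
  interpret prob_space "PiM I M" by (intro prob_space_PiM M)
  define d where "d = (\<Sum>i\<in>I. (c i)\<^sup>2)"
  \<comment> \<open>The minimiser of the exponent \<open>l\<^sup>2 * d / 8 - l * t\<close>, where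
    its value is \<open>- 2 * t\<^sup>2 / d\<close>.\<close>
  define l where "l = 4 * t / d"
  define \<mu> where "\<mu> = (\<integral>x. f x \<partial>PiM I M)"
  have d: "d > 0" and l: "l > 0" using pos False t by (auto simp: d_def l_def)
  have int: "integrable (PiM I M) (\<lambda>x. exp (l * (f x - \<mu>)))"
  proof (rule integrable_const_bound[where B = "exp (l * (B - \<mu>))"])
    show "AE x in PiM I M. norm (exp (l * (f x - \<mu>))) \<le> exp (l * (B - \<mu>))"
      using bd l by (intro AE_I2) (auto intro!: mult_left_mono dest: abs_le_D1)
  qed measurable
  have "prob {x \<in> space (PiM I M). f x \<ge> \<mu> + t} = prob {x \<in> space (PiM I M). f x - \<mu> \<ge> t}"
    by (simp add: algebra_simps)
  also have "\<dots> \<le> exp (- l * t) * (\<integral>x\<in>space (PiM I M). exp (l * (f x - \<mu>)) \<partial>PiM I M)"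
    by (rule Chernoff_ineq_ge) (use l integrable_mult_indicator[OF _ int, of "space (PiM I M)"] in \<open>auto simp: set_integrable_def\<close>)
  also have "\<dots> = exp (- l * t) * (\<integral>x. exp (l * (f x - \<mu>)) \<partial>PiM I M)"
    using int by (simp add: set_integral_space)
  also have "\<dots> \<le> exp (- l * t) * exp (l\<^sup>2 * d / 8)"
    unfolding \<mu>_def d_def
    by (intro mult_left_mono mcdiarmid_mgf[where B = B] M I l f bd diff) auto
  also have "\<dots> = exp (- 2 * t\<^sup>2 / d)"
    using d by (simp add: exp_add[symmetric] l_def field_simps power2_eq_square)
  finally show ?thesis by (simp add: \<mu>_def d_def)
qed

subsection \<open>Sign vectors and the contraction principle\<close>

abbreviation sign_vectors :: "'i set \<Rightarrow> ('i \<Rightarrow> real) set" where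
  "sign_vectors I \<equiv> PiE I (\<lambda>_. {-1, 1})"

lemma sign_vectors_cases: "\<epsilon> \<in> sign_vectors I \<Longrightarrow> i \<in> I \<Longrightarrow> \<epsilon> i = -1 \<or> \<epsilon> i = 1"
  by (auto dest: PiE_mem)

lemma sum_sign_vectors_insert:
  fixes g :: "('i \<Rightarrow> real) \<Rightarrow> real"
  assumes "i \<notin> I"
  shows "(\<Sum>\<epsilon>\<in>sign_vectors (insert i I). g \<epsilon>) = (\<Sum>\<epsilon>\<in>sign_vectors I. g (\<epsilon>(i := -1)) + g (\<epsilon>(i := 1)))"
proof -
  have "(\<Sum>\<epsilon>\<in>sign_vectors (insert i I). g \<epsilon>)
      = (\<Sum>(y, \<epsilon>)\<in>{-1, 1} \<times> sign_vectors I. g (\<epsilon>(i := y)))"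
    using inj_combinator[OF assms, of "\<lambda>_. {-1, 1 :: real}"]
    by (subst PiE_insert_eq, subst sum.reindex) (auto simp: case_prod_unfold)
  also have "\<dots> = (\<Sum>y\<in>{-1, 1}. \<Sum>\<epsilon>\<in>sign_vectors I. g (\<epsilon>(i := y)))"
    by (simp add: sum.cartesian_product)
  finally show ?thesis by (simp add: sum.distrib)
qed

lemma sum_sign_vectors_uminus:
  fixes g :: "('i \<Rightarrow> real) \<Rightarrow> real"
  shows "(\<Sum>\<epsilon>\<in>sign_vectors I. g (\<lambda>i\<in>I. - \<epsilon> i)) = (\<Sum>\<epsilon>\<in>sign_vectors I. g \<epsilon>)"
  by (rule sum.reindex_bij_witness[where i = "\<lambda>\<epsilon>. \<lambda>i\<in>I. - \<epsilon> i" and j = "\<lambda>\<epsilon>. \<lambda>i\<in>I. - \<epsilon> i"])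
     (auto simp: fun_eq_iff PiE_iff extensional_def)

text \<open>A box with sides \<open>A i\<close> has mass \<open>card (A i) / 2\<close>, multiplied
  over \<open>i\<close>, under both measures, and boxes determine a finite product measure.
  Expectations over the signs thereby become finite averages.\<close>

lemma rademacher_signs_eq_uniform:
  "rademacher_signs n = uniform_count_measure (sign_vectors {..<n})"
proof -
  let ?U = "\<lambda>_::nat. uniform_count_measure {-1, 1 :: real}"
  interpret U: prob_space "?U i" for i by (rule prob_space_uniform_count_measure) auto
  interpret product_prob_space ?U UNIV by unfold_locales
  have fin: "finite (sign_vectors {..<n})" by (intro finite_PiE) auto
  have "uniform_count_measure (sign_vectors {..<n}) = PiM {..<n} ?U"
  proof (rule PiM_eqI)
    have "sets (PiM {..<n} ?U) = sets (PiM {..<n} (\<lambda>_. count_space {-1, 1}))"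
      by (intro sets_PiM_cong refl sets_uniform_count_measure_count_space)
    also have "\<dots> = Pow (sign_vectors {..<n})"
      by (subst count_space_PiM_finite) auto
    finally show "sets (uniform_count_measure (sign_vectors {..<n})) = sets (PiM {..<n} ?U)"
      by (simp add: sets_uniform_count_measure)
  next
    fix A :: "nat \<Rightarrow> real set" assume "\<And>i. i \<in> {..<n} \<Longrightarrow> A i \<in> sets (?U i)"
    then have A: "A i \<subseteq> {-1, 1}" if "i < n" for i using that by (auto simp: sets_uniform_count_measure)
    then have "PiE {..<n} A \<subseteq> sign_vectors {..<n}" by (intro PiE_mono) auto
    then have "emeasure (uniform_count_measure (sign_vectors {..<n})) (PiE {..<n} A)
        = (\<Prod>i<n. real (card (A i))) / 2 ^ n"
      by (subst emeasure_uniform_count_measure[OF fin]) (auto simp: card_PiE numeral_2_eq_2)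
    also have "(\<Prod>i<n. real (card (A i))) / 2 ^ n = (\<Prod>i<n. real (card (A i)) / 2)"
      by (simp add: prod_dividef)
    also have "ennreal (\<Prod>i<n. real (card (A i)) / 2) = (\<Prod>i<n. ennreal (real (card (A i)) / 2))" by (simp add: prod_ennreal)
    also have "\<dots> = (\<Prod>i<n. emeasure (?U i) (A i))"
      using A by (intro prod.cong refl, subst emeasure_uniform_count_measure)
        (auto simp: numeral_2_eq_2)
    finally show "emeasure (uniform_count_measure (sign_vectors {..<n})) (PiE {..<n} A)
        = (\<Prod>i<n. emeasure (?U i) (A i))" .
  qed simp
  then show ?thesis by (simp add: rademacher_signs_def)
qed

lemma space_rademacher_signs: "space (rademacher_signs n) = sign_vectors {..<n}"
  by (simp add: rademacher_signs_eq_uniform space_uniform_count_measure)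

lemma prob_space_rademacher_signs: "prob_space (rademacher_signs n)"
  unfolding rademacher_signs_eq_uniform
  by (rule prob_space_uniform_count_measure) (auto intro!: finite_PiE simp: PiE_eq_empty_iff)

lemma integral_rademacher_signs:
  "(\<integral>\<epsilon>. g \<epsilon> \<partial>rademacher_signs n) = (\<Sum>\<epsilon>\<in>sign_vectors {..<n}. g \<epsilon>) / 2 ^ n" for g :: "_ \<Rightarrow> real"
  unfolding rademacher_signs_eq_uniform
  by (subst integral_uniform_count_measure) (auto intro!: finite_PiE simp: card_PiE numeral_2_eq_2)

text \<open>Both suprema are attained up to an arbitrary error at some \<open>s\<close> and \<open>t\<close>; exchanging \<open>s\<close> and \<open>t\<close>
  if necessary, \<open>\<phi> s - \<phi> t\<close> can be replaced by \<open>\<psi> s - \<psi> t\<close>.\<close>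

lemma contraction_step:
  fixes u \<phi> \<psi> :: "'t \<Rightarrow> real"
  assumes "T \<noteq> {}"
    and lip: "\<And>s t. s \<in> T \<Longrightarrow> t \<in> T \<Longrightarrow> \<bar>\<phi> s - \<phi> t\<bar> \<le> \<bar>\<psi> s - \<psi> t\<bar>"
    and bdd: "bdd_above ((\<lambda>t. u t - \<psi> t) ` T)" "bdd_above ((\<lambda>t. u t + \<psi> t) ` T)"
  shows "(SUP t\<in>T. u t - \<phi> t) + (SUP t\<in>T. u t + \<phi> t) \<le> (SUP t\<in>T. u t - \<psi> t) + (SUP t\<in>T. u t + \<psi> t)"
    (is "?L \<le> ?R")
proof -
  have pair: "(u s - \<phi> s) + (u t + \<phi> t) \<le> ?R" if s: "s \<in> T" and t: "t \<in> T" for s t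
  proof -
    have "u s - \<psi> s \<le> (SUP t\<in>T. u t - \<psi> t)" "u t - \<psi> t \<le> (SUP t\<in>T. u t - \<psi> t)"
      "u s + \<psi> s \<le> (SUP t\<in>T. u t + \<psi> t)" "u t + \<psi> t \<le> (SUP t\<in>T. u t + \<psi> t)"
      using bdd s t by (auto intro: cSUP_upper)
    then show ?thesis using lip[OF s t] by linarith
  qed
  have "u s - \<phi> s \<le> ?R - (SUP t\<in>T. u t + \<phi> t)" if s: "s \<in> T" for s
  proof -
    have "(SUP t\<in>T. u t + \<phi> t) \<le> ?R - (u s - \<phi> s)"
      by (intro cSUP_least) (use assms(1) pair[OF s] in \<open>auto simp: algebra_simps\<close>)
    then show ?thesis by linarith
  qed
  then have "(SUP t\<in>T. u t - \<phi> t) \<le> ?R - (SUP t\<in>T. u t + \<phi> t)"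
    by (intro cSUP_least) (use assms(1) in auto)
  then show ?thesis by linarith
qed

lemma bdd_above_sign_sum:
  fixes u :: "'t \<Rightarrow> real" and \<psi> :: "'i \<Rightarrow> 't \<Rightarrow> real"
  assumes u: "\<And>t. t \<in> T \<Longrightarrow> \<bar>u t\<bar> \<le> B" and \<psi>: "\<And>i t. i \<in> I \<Longrightarrow> t \<in> T \<Longrightarrow> \<bar>\<psi> i t\<bar> \<le> C"
    and \<epsilon>: "\<epsilon> \<in> sign_vectors I"
  shows "bdd_above ((\<lambda>t. u t + (\<Sum>i\<in>I. \<epsilon> i * \<psi> i t)) ` T)"
proof (rule bdd_aboveI2)
  fix t assume t: "t \<in> T"
  have "\<epsilon> i * \<psi> i t \<le> C" if "i \<in> I" for i
    using sign_vectors_cases[OF \<epsilon> that] \<psi>[OF that t] by (auto simp: abs_le_iff)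
  then have "(\<Sum>i\<in>I. \<epsilon> i * \<psi> i t) \<le> (\<Sum>i\<in>I. C)" by (intro sum_mono)
  with u[OF t] show "u t + (\<Sum>i\<in>I. \<epsilon> i * \<psi> i t) \<le> B + (\<Sum>i\<in>I. C)" by (simp add: abs_le_iff)
qed

text \<open>The coordinates are exchanged one at a time. Induction with arbitrary \<open>u\<close>
  works because, for a fixed sign at \<open>i\<close>, the summand of \<open>i\<close> can be
  absorbed into \<open>u\<close>; once \<phi> has been replaced by \<psi> on \<open>I\<close>, the
  two signs at \<open>i\<close> are paired and \<open>contraction_step\<close> replaces it there as
  well.\<close>

lemma contraction:
  fixes u :: "'t \<Rightarrow> real" and \<phi> \<psi> :: "'i \<Rightarrow> 't \<Rightarrow> real"
  assumes "finite I" and T: "T \<noteq> {}"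
    and "\<And>i s t. i \<in> I \<Longrightarrow> s \<in> T \<Longrightarrow> t \<in> T \<Longrightarrow> \<bar>\<phi> i s - \<phi> i t\<bar> \<le> \<bar>\<psi> i s - \<psi> i t\<bar>"
    and "\<And>i t. i \<in> I \<Longrightarrow> t \<in> T \<Longrightarrow> \<bar>\<phi> i t\<bar> \<le> C"
    and "\<And>i t. i \<in> I \<Longrightarrow> t \<in> T \<Longrightarrow> \<bar>\<psi> i t\<bar> \<le> C"
    and "\<And>t. t \<in> T \<Longrightarrow> \<bar>u t\<bar> \<le> B"
  shows "(\<Sum>\<epsilon>\<in>sign_vectors I. SUP t\<in>T. u t + (\<Sum>i\<in>I. \<epsilon> i * \<phi> i t))
       \<le> (\<Sum>\<epsilon>\<in>sign_vectors I. SUP t\<in>T. u t + (\<Sum>i\<in>I. \<epsilon> i * \<psi> i t))"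
  using assms(1,3-)
proof (induction I arbitrary: u B rule: finite_induct)
  case empty
  then show ?case by simp
next
  case (insert i I)
  have upd: "(\<Sum>j\<in>insert i I. (\<epsilon>(i := y)) j * \<theta> j t) = y * \<theta> i t + (\<Sum>j\<in>I. \<epsilon> j * \<theta> j t)"
    for \<epsilon> y t and \<theta> :: "'i \<Rightarrow> 't \<Rightarrow> real"
  proof -
    have "(\<Sum>j\<in>I. (\<epsilon>(i := y)) j * \<theta> j t) = (\<Sum>j\<in>I. \<epsilon> j * \<theta> j t)"
      using insert.hyps by (intro sum.cong) auto
    then show ?thesis using insert.hyps by simp
  qed
  \<comment> \<open>The new \<open>u\<close> for the induction hypothesis, with the summand of
    \<open>i\<close> at sign \<open>y\<close> absorbed; its bound grows from \<open>B\<close> to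
    \<open>B + C\<close>.\<close>
  define v where "v y t = u t + y * \<phi> i t" for y t
  have v_bd: "\<bar>v y t\<bar> \<le> B + C" if "t \<in> T" "y = -1 \<or> y = 1" for y t
    using insert.prems(2)[of i t] insert.prems(4)[of t] that by (auto simp: v_def)
  have "(\<Sum>\<epsilon>\<in>sign_vectors (insert i I). SUP t\<in>T. u t + (\<Sum>j\<in>insert i I. \<epsilon> j * \<phi> j t))
      = (\<Sum>\<epsilon>\<in>sign_vectors I. SUP t\<in>T. v (-1) t + (\<Sum>j\<in>I. \<epsilon> j * \<phi> j t))
        + (\<Sum>\<epsilon>\<in>sign_vectors I. SUP t\<in>T. v 1 t + (\<Sum>j\<in>I. \<epsilon> j * \<phi> j t))"
    unfolding sum_sign_vectors_insert[OF insert.hyps(2)] upd v_def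
    by (subst sum.distrib, rule arg_cong2[where f = "(+)"]; intro sum.cong SUP_cong refl; simp)
  also have "\<dots> \<le> (\<Sum>\<epsilon>\<in>sign_vectors I. SUP t\<in>T. v (-1) t + (\<Sum>j\<in>I. \<epsilon> j * \<psi> j t))
        + (\<Sum>\<epsilon>\<in>sign_vectors I. SUP t\<in>T. v 1 t + (\<Sum>j\<in>I. \<epsilon> j * \<psi> j t))"
    by (intro add_mono insert.IH[where B = "B + C"] v_bd insert.prems) auto
  \<comment> \<open>Regrouped by \<epsilon>, each pair of suprema has the form of
    \<open>contraction_step\<close>, the common part being \<open>u\<close> together with the \<psi>
    terms on \<open>I\<close>.\<close>
  also have "\<dots> = (\<Sum>\<epsilon>\<in>sign_vectors I.
      (SUP t\<in>T. (u t + (\<Sum>j\<in>I. \<epsilon> j * \<psi> j t)) - \<phi> i t) +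
      (SUP t\<in>T. (u t + (\<Sum>j\<in>I. \<epsilon> j * \<psi> j t)) + \<phi> i t))"
    unfolding v_def
    by (subst sum.distrib, rule arg_cong2[where f = "(+)"]; intro sum.cong SUP_cong refl; simp)
  also have "\<dots> \<le> (\<Sum>\<epsilon>\<in>sign_vectors I.
      (SUP t\<in>T. (u t + (\<Sum>j\<in>I. \<epsilon> j * \<psi> j t)) - \<psi> i t) +
      (SUP t\<in>T. (u t + (\<Sum>j\<in>I. \<epsilon> j * \<psi> j t)) + \<psi> i t))"
  proof (intro sum_mono contraction_step T)
    fix \<epsilon> :: "'i \<Rightarrow> real" assume \<epsilon>: "\<epsilon> \<in> sign_vectors I"
    have "bdd_above ((\<lambda>t. (u t - \<psi> i t) + (\<Sum>j\<in>I. \<epsilon> j * \<psi> j t)) ` T)"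
    proof (rule bdd_above_sign_sum[OF _ _ \<epsilon>])
      show "\<bar>u t - \<psi> i t\<bar> \<le> B + C" if "t \<in> T" for t
        using insert.prems(3)[of i t] insert.prems(4)[of t] that by auto
    qed (use insert.prems(3) in auto)
    then show "bdd_above ((\<lambda>t. (u t + (\<Sum>j\<in>I. \<epsilon> j * \<psi> j t)) - \<psi> i t) ` T)"
      by (simp add: algebra_simps)
    have "bdd_above ((\<lambda>t. (u t + \<psi> i t) + (\<Sum>j\<in>I. \<epsilon> j * \<psi> j t)) ` T)"
    proof (rule bdd_above_sign_sum[OF _ _ \<epsilon>])
      show "\<bar>u t + \<psi> i t\<bar> \<le> B + C" if "t \<in> T" for t
        using insert.prems(3)[of i t] insert.prems(4)[of t] that by auto
    qed (use insert.prems(3) in auto)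
    then show "bdd_above ((\<lambda>t. (u t + (\<Sum>j\<in>I. \<epsilon> j * \<psi> j t)) + \<psi> i t) ` T)"
      by (simp add: algebra_simps)
  qed (use insert.prems(1) in auto)
  also have "\<dots> = (\<Sum>\<epsilon>\<in>sign_vectors (insert i I). SUP t\<in>T. u t + (\<Sum>j\<in>insert i I. \<epsilon> j * \<psi> j t))"
    unfolding sum_sign_vectors_insert[OF insert.hyps(2)] upd
    by (intro sum.cong refl, rule arg_cong2[where f = "(+)"]; intro SUP_cong refl; simp)
  finally show ?case .
qed

subsection \<open>Symmetrization\<close>

text \<open>Two independent samples may be mixed coordinatewise, by a fixed rule, without changing
  the law: the preimage of a box is a product of two boxes, and the coordinates left free contribute
  the factor 1.\<close>

lemma distr_PiM_exchange:
  assumes P: "prob_space P" and I: "finite I"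
  shows "distr (PiM I (\<lambda>_. P) \<Otimes>\<^sub>M PiM I (\<lambda>_. P)) (PiM I (\<lambda>_. P))
           (\<lambda>(x, y). \<lambda>i\<in>I. if i \<in> J then x i else y i) = PiM I (\<lambda>_. P)"
    (is "distr ?PP ?Q ?X = _")
proof -
  interpret p: prob_space P by fact
  interpret product_prob_space "\<lambda>_. P" UNIV by unfold_locales
  interpret Q: prob_space ?Q by (rule prob_space_PiM) unfold_locales
  show ?thesis
  proof (rule PiM_eqI[OF I])
    fix A assume A: "\<And>i. i \<in> I \<Longrightarrow> A i \<in> sets P"
    \<comment> \<open>\<open>A1\<close> constrains the coordinates taken from the first sample and
      \<open>A2\<close> those taken from the second.\<close>
    define A1 where "A1 i = (if i \<in> J then A i else space P)" for i
    define A2 where "A2 i = (if i \<in> J then space P else A i)" for i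
    have [measurable]: "A1 i \<in> sets P" "A2 i \<in> sets P" if "i \<in> I" for i
      using A[OF that] by (auto simp: A1_def A2_def)
    have "?X -` PiE I A \<inter> space ?PP = PiE I A1 \<times> PiE I A2"
      using A[THEN sets.sets_into_space]
      by (auto simp: space_pair_measure space_PiM PiE_iff A1_def A2_def split: if_splits) blast+
    then have "emeasure (distr ?PP ?Q ?X) (PiE I A) = emeasure ?PP (PiE I A1 \<times> PiE I A2)"
      using A I by (subst emeasure_distr) auto
    also have "\<dots> = (\<Prod>i\<in>I. emeasure P (A1 i)) * (\<Prod>i\<in>I. emeasure P (A2 i))"
      using I by (subst Q.emeasure_pair_measure_Times) (auto simp: emeasure_PiM)
    also have "\<dots> = (\<Prod>i\<in>I. emeasure P (A i))"
      unfolding prod.distrib[symmetric]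
      by (intro prod.cong) (auto simp: A1_def A2_def p.emeasure_space_1)
    finally show "emeasure (distr ?PP ?Q ?X) (PiE I A) = (\<Prod>i\<in>I. emeasure P (A i))" .
  qed simp
qed

section \<open>Rademacher complexity of a uniformly bounded class\<close>

locale rademacher_class = prob_space P
  for P :: "'z measure" +
  fixes n :: nat and F :: "('z \<Rightarrow> real) set" and B :: real
  assumes class_nonempty: "F \<noteq> {}"
    and class_bound: "f \<in> F \<Longrightarrow> \<bar>f z\<bar> \<le> B"
    and sup_measurable: "rademacher_sup n F \<in> borel_measurable (PiM {..<n} (\<lambda>_. P) \<Otimes>\<^sub>M rademacher_signs n)"
begin

abbreviation samples :: "(nat \<Rightarrow> 'z) measure" where
  "samples \<equiv> PiM {..<n} (\<lambda>_. P)"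

sublocale S: prob_space samples
  by (intro prob_space_PiM) unfold_locales

lemma correlation_bound:
  assumes f: "f \<in> F" and \<epsilon>: "\<epsilon> \<in> sign_vectors {..<n}"
  shows "\<bar>(1 / real n) * (\<Sum>i<n. \<epsilon> i * f (S i))\<bar> \<le> B"
proof (cases "n = 0")
  \<comment> \<open>Here \<open>1 / real n\<close> is 0, so only \<open>B \<ge> 0\<close> is to be
    shown, and \<open>B\<close> bounds an absolute value.\<close>
  case True
  with class_bound[OF f, of undefined] show ?thesis by auto
next
  case False
  have "\<bar>\<Sum>i<n. \<epsilon> i * f (S i)\<bar> \<le> (\<Sum>i<n. \<bar>\<epsilon> i * f (S i)\<bar>)" by (rule sum_abs)
  also have "\<dots> \<le> (\<Sum>i<n. B)"
    using sign_vectors_cases[OF \<epsilon>] class_bound[OF f] by (intro sum_mono) (force simp: abs_mult)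
  finally show ?thesis using False by (simp add: abs_mult field_simps)
qed

lemma rademacher_sup_upper:
  assumes "f \<in> F" and "\<epsilon> \<in> sign_vectors {..<n}"
  shows "(1 / real n) * (\<Sum>i<n. \<epsilon> i * f (S i)) \<le> rademacher_sup n F (S, \<epsilon>)"
proof -
  have "bdd_above ((\<lambda>f. (1 / real n) * (\<Sum>i<n. \<epsilon> i * f (S i))) ` F)"
    using correlation_bound assms(2) by (intro bdd_aboveI2[of _ _ B]) (simp only: abs_le_iff)
  then show ?thesis unfolding rademacher_sup_def prod.case by (rule cSUP_upper[OF assms(1)])
qed

lemma rademacher_sup_least:
  assumes "\<And>f. f \<in> F \<Longrightarrow> (1 / real n) * (\<Sum>i<n. \<epsilon> i * f (S i)) \<le> b"
  shows "rademacher_sup n F (S, \<epsilon>) \<le> b"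
  unfolding rademacher_sup_def prod.case by (rule cSUP_least[OF class_nonempty assms])

lemma abs_rademacher_sup_le:
  assumes \<epsilon>: "\<epsilon> \<in> sign_vectors {..<n}"
  shows "\<bar>rademacher_sup n F (S, \<epsilon>)\<bar> \<le> B"
proof (rule abs_leI)
  show "rademacher_sup n F (S, \<epsilon>) \<le> B"
    using correlation_bound[OF _ \<epsilon>] by (intro rademacher_sup_least) (simp only: abs_le_iff)
  obtain f where "f \<in> F" using class_nonempty by auto
  then show "- rademacher_sup n F (S, \<epsilon>) \<le> B"
    using correlation_bound[OF _ \<epsilon>, of f S] rademacher_sup_upper[OF _ \<epsilon>, of f S] by linarith
qed

lemma measurable_rademacher_sup[measurable]:
  assumes "\<epsilon> \<in> sign_vectors {..<n}"
  shows "(\<lambda>S. rademacher_sup n F (S, \<epsilon>)) \<in> borel_measurable samples"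
  by (rule measurable_Pair1[OF sup_measurable]) (simp add: assms space_rademacher_signs)

lemma integrable_rademacher_sup:
  assumes "\<epsilon> \<in> sign_vectors {..<n}"
  shows "integrable samples (\<lambda>S. rademacher_sup n F (S, \<epsilon>))"
  using assms abs_rademacher_sup_le by (intro S.integrable_const_bound[of _ B]) auto

text \<open>Fubini, with the inner integral over the signs written as a finite average. Later
  estimates can then be made for each sample separately.\<close>

lemma rademacher_complexity_eq:
  "rademacher_complexity n P F
     = (\<integral>S. (\<Sum>\<epsilon>\<in>sign_vectors {..<n}. rademacher_sup n F (S, \<epsilon>)) / 2 ^ n \<partial>samples)"
proof -
  interpret R: prob_space "rademacher_signs n" by (rule prob_space_rademacher_signs)
  interpret SR: pair_prob_space samples "rademacher_signs n" by unfold_locales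
  have "integrable (samples \<Otimes>\<^sub>M rademacher_signs n) (rademacher_sup n F)"
    using sup_measurable abs_rademacher_sup_le
    by (intro SR.integrable_const_bound[of _ B])
       (auto simp: space_pair_measure space_rademacher_signs)
  then have "rademacher_complexity n P F
      = (\<integral>S. (\<integral>\<epsilon>. rademacher_sup n F (S, \<epsilon>) \<partial>rademacher_signs n) \<partial>samples)"
    unfolding rademacher_complexity_def by (rule SR.integral_fst'[symmetric])
  then show ?thesis by (simp add: integral_rademacher_signs)
qed

text \<open>Contraction with \<phi> = 0, whose increments are dominated by those of any \<psi>,
  gives nonnegativity of the sum over the signs for every sample.\<close>

lemma rademacher_complexity_nonneg: "0 \<le> rademacher_complexity n P F"
  unfolding rademacher_complexity_eq
proof (intro integral_nonneg_AE AE_I2 divide_nonneg_nonneg)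
  fix S
  have "(\<Sum>\<epsilon>\<in>sign_vectors {..<n}. SUP f\<in>F. 0 + (\<Sum>i<n. \<epsilon> i * 0))
      \<le> (\<Sum>\<epsilon>\<in>sign_vectors {..<n}. SUP f\<in>F. 0 + (\<Sum>i<n. \<epsilon> i * ((1 / real n) * f (S i))))"
  proof (rule contraction[where B = 0])
    show "\<bar>1 / real n * f (S i)\<bar> \<le> (1 / real n) * B" if "f \<in> F" for i f
      unfolding abs_mult using class_bound[OF that] by (intro mult_mono) auto
    show "\<bar>0 :: real\<bar> \<le> (1 / real n) * B"
      using class_nonempty class_bound[THEN order_trans[OF abs_ge_zero]] by auto
  qed (use class_nonempty in auto)
  also have "\<dots> = (\<Sum>\<epsilon>\<in>sign_vectors {..<n}. rademacher_sup n F (S, \<epsilon>))"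
    by (simp add: rademacher_sup_def sum_distrib_left mult.left_commute sum_divide_distrib)
  finally show "0 \<le> (\<Sum>\<epsilon>\<in>sign_vectors {..<n}. rademacher_sup n F (S, \<epsilon>))"
    using class_nonempty by simp
qed simp

text \<open>Negation permutes the sign vectors, so the average over \<epsilon> of the left-hand side
  is the right-hand side; some \<epsilon> is not above the average.\<close>

lemma exists_good_sign_vector:
  obtains \<epsilon> where "\<epsilon> \<in> sign_vectors {..<n}"
    and "(\<integral>S. rademacher_sup n F (S, \<epsilon>) \<partial>samples)
           + (\<integral>S. rademacher_sup n F (S, \<lambda>i\<in>{..<n}. - \<epsilon> i) \<partial>samples)
         \<le> 2 * rademacher_complexity n P F"
proof -
  let ?V = "sign_vectors {..<n}"
  define g where "g \<epsilon> = (\<integral>S. rademacher_sup n F (S, \<epsilon>) \<partial>samples)" for \<epsilon>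
  have V: "finite ?V" "?V \<noteq> {}" "card ?V = 2 ^ n"
    by (auto intro!: finite_PiE simp: PiE_eq_empty_iff card_PiE numeral_2_eq_2)
  have R: "rademacher_complexity n P F = (\<Sum>\<epsilon>\<in>?V. g \<epsilon>) / 2 ^ n"
    unfolding rademacher_complexity_eq g_def
    using integrable_rademacher_sup by (simp add: Bochner_Integration.integral_sum)
  have "\<exists>\<epsilon>\<in>?V. g \<epsilon> + g (\<lambda>i\<in>{..<n}. - \<epsilon> i) \<le> 2 * rademacher_complexity n P F"
  proof (rule ccontr)
    assume "\<not> ?thesis"
    then have "(\<Sum>\<epsilon>\<in>?V. 2 * rademacher_complexity n P F)
        < (\<Sum>\<epsilon>\<in>?V. g \<epsilon> + g (\<lambda>i\<in>{..<n}. - \<epsilon> i))"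
      using V by (intro sum_strict_mono) auto
    also have "\<dots> = 2 * (\<Sum>\<epsilon>\<in>?V. g \<epsilon>)"
      by (simp add: sum.distrib sum_sign_vectors_uminus)
    finally show False using V by (simp add: R)
  qed
  with that show ?thesis by (auto simp: g_def)
qed

end

locale unit_rademacher_class = rademacher_class P n F 1
  for P :: "'z measure" and n F +
  assumes n_pos: "n > 0"
    and class_nonneg: "f \<in> F \<Longrightarrow> 0 \<le> f z"
    and class_measurable[measurable]: "f \<in> F \<Longrightarrow> f \<in> borel_measurable P"
begin

text \<open>Only the summand of \<open>i\<close> changes, and it changes by at most 1 since
  \<open>f\<close> takes values in [0, 1]. This gives \<open>1 / real n\<close> instead of the
  \<open>2 / real n\<close> of a class with values in [-1, 1].\<close>

lemma rademacher_sup_bounded_difference: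
  assumes \<epsilon>: "\<epsilon> \<in> sign_vectors {..<n}" and eq: "\<And>j. j \<noteq> i \<Longrightarrow> S j = S' j"
  shows "\<bar>rademacher_sup n F (S, \<epsilon>) - rademacher_sup n F (S', \<epsilon>)\<bar> \<le> 1 / real n"
proof -
  have le: "rademacher_sup n F (S, \<epsilon>) \<le> rademacher_sup n F (S', \<epsilon>) + 1 / real n"
    if eq: "\<And>j. j \<noteq> i \<Longrightarrow> S j = S' j" for S S'
  proof (rule rademacher_sup_least)
    fix f assume f: "f \<in> F"
    have "\<epsilon> j * f (S j) \<le> \<epsilon> j * f (S' j) + (if i = j then 1 else 0)" if "j < n" for j
      using sign_vectors_cases[OF \<epsilon>, of j] that eq[of j] class_bound[OF f, of "S j"]
        class_bound[OF f, of "S' j"] class_nonneg[OF f, of "S j"] class_nonneg[OF f, of "S' j"]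
      by (auto split: if_splits)
    then have "(\<Sum>j<n. \<epsilon> j * f (S j)) \<le> (\<Sum>j<n. \<epsilon> j * f (S' j) + (if i = j then 1 else 0))"
      by (intro sum_mono) auto
    also have "\<dots> \<le> (\<Sum>j<n. \<epsilon> j * f (S' j)) + 1"
      by (simp add: sum.distrib)
    finally have "(1 / real n) * (\<Sum>j<n. \<epsilon> j * f (S j))
        \<le> (1 / real n) * ((\<Sum>j<n. \<epsilon> j * f (S' j)) + 1)"
      by (intro mult_left_mono) auto
    also have "\<dots> \<le> rademacher_sup n F (S', \<epsilon>) + 1 / real n"
      using rademacher_sup_upper[OF f \<epsilon>, of S'] by (simp add: distrib_left)
    finally show "(1 / real n) * (\<Sum>j<n. \<epsilon> j * f (S j)) \<le> rademacher_sup n F (S', \<epsilon>) + 1 / real n" .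
  qed
  show ?thesis using le[of S S'] le[of S' S] eq by fastforce
qed

text \<open>The supremum of \<open>E f - \<Sum>i<n. f (S i) / n\<close> over \<open>F\<close> need not be measurable. Symmetrization is
  therefore carried out for one sign vector \<open>\<epsilon>\<close>, chosen such that the bound on the expectation is
  at most twice the Rademacher complexity: the integral over a ghost sample in the proof below is a
  measurable majorant of that supremum which still has bounded differences.\<close>

theorem uniform_deviation:
  assumes t: "t \<ge> 0"
  obtains A where "A \<in> sets samples" and "measure samples A \<ge> 1 - exp (- 2 * real n * t\<^sup>2)"
    and "\<And>S f. S \<in> A \<Longrightarrow> f \<in> F \<Longrightarrow>
           (\<integral>z. f z \<partial>P) \<le> (1 / real n) * (\<Sum>i<n. f (S i)) + 2 * rademacher_complexity n P F + t"
proof -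
  obtain \<epsilon> where \<epsilon>: "\<epsilon> \<in> sign_vectors {..<n}"
    and \<epsilon>_le: "(\<integral>S. rademacher_sup n F (S, \<epsilon>) \<partial>samples)
           + (\<integral>S. rademacher_sup n F (S, \<lambda>i\<in>{..<n}. - \<epsilon> i) \<partial>samples)
         \<le> 2 * rademacher_complexity n P F"
    by (rule exists_good_sign_vector)
  define \<epsilon>' where "\<epsilon>' = (\<lambda>i\<in>{..<n}. - \<epsilon> i)"
  have \<epsilon>': "\<epsilon>' \<in> sign_vectors {..<n}" using sign_vectors_cases[OF \<epsilon>] by (auto simp: \<epsilon>'_def PiE_iff)
  \<comment> \<open>\<open>X J\<close> takes the coordinates in \<open>J\<close> from the sample
    \<open>S\<close> and the others from the ghost sample \<open>S'\<close>; by the exchange lemma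
    it is again distributed as a sample.\<close>
  define J where "J = {i. \<epsilon> i = 1}"
  define X where "X J S S' = (\<lambda>i\<in>{..<n}. if i \<in> J then S i else S' i)" for J and S S' :: "nat \<Rightarrow> 'z"
  have X_meas[measurable]: "(\<lambda>(S, S'). X J S S') \<in> samples \<Otimes>\<^sub>M samples \<rightarrow>\<^sub>M samples" for J
    unfolding X_def case_prod_unfold by (intro measurable_restrict) auto
  interpret SS: pair_prob_space samples samples by unfold_locales
  have X_int: "(\<integral>p. rademacher_sup n F (X J (fst p) (snd p), \<eta>) \<partial>(samples \<Otimes>\<^sub>M samples))
      = (\<integral>S. rademacher_sup n F (S, \<eta>) \<partial>samples)"
    if \<eta>: "\<eta> \<in> sign_vectors {..<n}" for J \<eta>
  proof -
    have "(\<integral>S. rademacher_sup n F (S, \<eta>) \<partial>samples)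
        = (\<integral>S. rademacher_sup n F (S, \<eta>) \<partial>distr (samples \<Otimes>\<^sub>M samples) samples (\<lambda>(S, S'). X J S S'))"
      unfolding X_def by (subst distr_PiM_exchange) (auto intro: prob_space_axioms)
    also have "\<dots> = (\<integral>p. rademacher_sup n F (X J (fst p) (snd p), \<eta>) \<partial>(samples \<Otimes>\<^sub>M samples))"
      using \<eta> by (subst integral_distr) (auto simp: case_prod_unfold)
    finally show ?thesis ..
  qed
  have rs_meas[measurable]:
    "(\<lambda>(S, S'). rademacher_sup n F (X J S S', \<eta>)) \<in> borel_measurable (samples \<Otimes>\<^sub>M samples)"
    if \<eta>: "\<eta> \<in> sign_vectors {..<n}" for J \<eta>
    using measurable_compose[OF X_meas measurable_rademacher_sup[OF \<eta>]]
    by (simp add: case_prod_unfold)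
  \<comment> \<open>In the first term \<epsilon> is 1 exactly where the point comes from
    \<open>S'\<close>, and in the second \<epsilon>' is 1 exactly there. Across both terms every
    \<open>S i\<close> thus appears once with sign -1 and every \<open>S' i\<close> once with sign
    1.\<close>
  define V where "V S S' = rademacher_sup n F (X (- J) S S', \<epsilon>) + rademacher_sup n F (X J S S', \<epsilon>')"
    for S S'
  have V_meas[measurable]: "(\<lambda>(S, S'). V S S') \<in> borel_measurable (samples \<Otimes>\<^sub>M samples)"
    unfolding V_def using rs_meas[OF \<epsilon>, of "-J"] rs_meas[OF \<epsilon>', of J]
    by (auto simp: case_prod_unfold)
  have V_bd: "\<bar>V S S'\<bar> \<le> 2" for S S'
    unfolding V_def
    using abs_rademacher_sup_le[OF \<epsilon>, of "X (- J) S S'"] abs_rademacher_sup_le[OF \<epsilon>', of "X J S S'"]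
    by linarith
  define W where "W S = (\<integral>S'. V S S' \<partial>samples)" for S
  have W_meas[measurable]: "W \<in> borel_measurable samples"
    unfolding W_def by measurable
  have V_int: "integrable samples (V S)" if S: "S \<in> space samples" for S
    using V_bd measurable_Pair2[OF V_meas S] by (intro S.integrable_const_bound[of _ 2]) auto
  have W_bd: "\<bar>W S\<bar> \<le> 2" if S: "S \<in> space samples" for S
  proof -
    have "\<bar>W S\<bar> \<le> (\<integral>S'. \<bar>V S S'\<bar> \<partial>samples)" unfolding W_def by (rule integral_abs_bound)
    also have "\<dots> \<le> 2" by (rule S.integral_le_const) (use V_int[OF S] V_bd in auto)
    finally show ?thesis .
  qed
  have W_diff: "\<bar>W (S(i := z)) - W S\<bar> \<le> 1 / real n"
    if S: "S \<in> space samples" and i: "i \<in> {..<n}" and z: "z \<in> space P" for S i z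
  proof -
    have Si: "S(i := z) \<in> space samples"
      using S i z by (auto simp: space_PiM PiE_def extensional_def Pi_def)
    \<comment> \<open>\<open>S i\<close> enters exactly one of the two mixed samples, so only one of
      the two suprema moves and the difference is not doubled.\<close>
    have "\<bar>V (S(i := z)) S' - V S S'\<bar> \<le> 1 / real n" for S'
    proof (cases "i \<in> J")
      case True
      have "X (- J) (S(i := z)) S' = X (- J) S S'" using True by (auto simp: X_def fun_eq_iff)
      moreover have "\<bar>rademacher_sup n F (X J (S(i := z)) S', \<epsilon>') - rademacher_sup n F (X J S S', \<epsilon>')\<bar>
          \<le> 1 / real n"
        by (rule rademacher_sup_bounded_difference[OF \<epsilon>', of i]) (auto simp: X_def)
      ultimately show ?thesis by (simp add: V_def)
    next
      case False
      have "X J (S(i := z)) S' = X J S S'" using False by (auto simp: X_def fun_eq_iff)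
      moreover have "\<bar>rademacher_sup n F (X (- J) (S(i := z)) S', \<epsilon>)
          - rademacher_sup n F (X (- J) S S', \<epsilon>)\<bar> \<le> 1 / real n"
        by (rule rademacher_sup_bounded_difference[OF \<epsilon>, of i]) (auto simp: X_def)
      ultimately show ?thesis by (simp add: V_def)
    qed
    then have "(\<integral>S'. \<bar>V (S(i := z)) S' - V S S'\<bar> \<partial>samples) \<le> 1 / real n"
      using V_int[OF S] V_int[OF Si] by (intro S.integral_le_const) auto
    moreover have "\<bar>\<integral>S'. V (S(i := z)) S' - V S S' \<partial>samples\<bar>
        \<le> (\<integral>S'. \<bar>V (S(i := z)) S' - V S S'\<bar> \<partial>samples)" by (rule integral_abs_bound)
    ultimately show ?thesis using V_int[OF S] V_int[OF Si] by (simp add: W_def)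
  qed
  have W_exp: "(\<integral>S. W S \<partial>samples) \<le> 2 * rademacher_complexity n P F"
  proof -
    have int: "integrable (samples \<Otimes>\<^sub>M samples) (\<lambda>p. rademacher_sup n F (X J (fst p) (snd p), \<eta>))"
      if "\<eta> \<in> sign_vectors {..<n}" for J \<eta>
      using abs_rademacher_sup_le[OF that] rs_meas[OF that, of J]
      by (intro SS.integrable_const_bound[of _ 1]) (auto simp: case_prod_unfold)
    have "(\<integral>S. W S \<partial>samples) = (\<integral>p. V (fst p) (snd p) \<partial>(samples \<Otimes>\<^sub>M samples))"
      unfolding W_def V_def
      by (subst SS.integral_fst'[symmetric]) (use int \<epsilon> \<epsilon>' in auto)
    also have "\<dots> = (\<integral>S. rademacher_sup n F (S, \<epsilon>) \<partial>samples)
        + (\<integral>S. rademacher_sup n F (S, \<epsilon>') \<partial>samples)"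
      unfolding V_def using int \<epsilon> \<epsilon>' by (simp add: X_int)
    finally show ?thesis using \<epsilon>_le by (simp add: \<epsilon>'_def)
  qed
  \<comment> \<open>The expectation of \<open>f\<close> is that of its mean over the ghost sample.
    For fixed \<open>S'\<close> the difference of the two empirical means splits into the two signed
    sums bounded by \<open>V S S'\<close>.\<close>
  have W_upper: "(\<integral>z. f z \<partial>P) - (1 / real n) * (\<Sum>i<n. f (S i)) \<le> W S"
    if f: "f \<in> F" and S: "S \<in> space samples" for f S
  proof -
    have f_int: "integrable samples (\<lambda>S. f (S i))" if "i < n" for i
      using that f class_bound[OF f]
      by (intro S.integrable_const_bound[of _ 1]) auto
    have avg_int: "integrable samples (\<lambda>S'. (1 / real n) * (\<Sum>i<n. f (S' i)))"
      by (intro integrable_mult_right Bochner_Integration.integrable_sum) (use f_int in auto)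
    have comp: "(\<integral>S. f (S i) \<partial>samples) = (\<integral>z. f z \<partial>P)" if "i < n" for i
    proof -
      have "(\<integral>z. f z \<partial>P) = (\<integral>z. f z \<partial>distr samples P (\<lambda>S. S i))"
        using that by (subst distr_PiM_component) (auto intro: prob_space_axioms)
      also have "\<dots> = (\<integral>S. f (S i) \<partial>samples)"
        using that f by (subst integral_distr) auto
      finally show ?thesis ..
    qed
    have "(\<integral>z. f z \<partial>P) - (1 / real n) * (\<Sum>i<n. f (S i))
        = (\<integral>S'. (1 / real n) * (\<Sum>i<n. f (S' i)) - (1 / real n) * (\<Sum>i<n. f (S i)) \<partial>samples)"
    proof -
      have "(\<integral>S'. (1 / real n) * (\<Sum>i<n. f (S' i)) \<partial>samples) = (\<integral>z. f z \<partial>P)"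
        using f_int n_pos by (simp add: comp Bochner_Integration.integral_sum)
      then show ?thesis
        using avg_int by (subst Bochner_Integration.integral_diff) (simp_all add: S.prob_space)
    qed
    also have "\<dots> \<le> W S"
      unfolding W_def
    proof (rule integral_mono)
      show "integrable samples
          (\<lambda>S'. (1 / real n) * (\<Sum>i<n. f (S' i)) - (1 / real n) * (\<Sum>i<n. f (S i)))"
        by (intro Bochner_Integration.integrable_diff avg_int) simp
      fix S'
      have "(\<Sum>i<n. f (S' i)) - (\<Sum>i<n. f (S i))
          = (\<Sum>i<n. \<epsilon> i * f (X (- J) S S' i)) + (\<Sum>i<n. \<epsilon>' i * f (X J S S' i))"
        unfolding sum_subtractf[symmetric] sum.distrib[symmetric]
        using sign_vectors_cases[OF \<epsilon>] by (intro sum.cong) (force simp: X_def \<epsilon>'_def J_def)+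
      then have "(1 / real n) * (\<Sum>i<n. f (S' i)) - (1 / real n) * (\<Sum>i<n. f (S i))
          = (1 / real n) * (\<Sum>i<n. \<epsilon> i * f (X (- J) S S' i))
            + (1 / real n) * (\<Sum>i<n. \<epsilon>' i * f (X J S S' i))"
        by (simp only: right_diff_distrib[symmetric] distrib_left[symmetric])
      also have "\<dots> \<le> V S S'"
        unfolding V_def by (intro add_mono rademacher_sup_upper f \<epsilon> \<epsilon>')
      finally show "(1 / real n) * (\<Sum>i<n. f (S' i)) - (1 / real n) * (\<Sum>i<n. f (S i)) \<le> V S S'" .
    qed (rule V_int[OF S])
    finally show ?thesis .
  qed
  define E where "E = {S \<in> space samples. W S \<ge> (\<integral>S. W S \<partial>samples) + t}"
  have [measurable]: "E \<in> sets samples" unfolding E_def by measurable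
  \<comment> \<open>The sum of squared differences in McDiarmid's inequality, which puts the factor
    \<open>n\<close> into the exponent.\<close>
  have "(\<Sum>i<n. (1 / real n)\<^sup>2) = 1 / real n" using n_pos by (simp add: power2_eq_square)
  moreover have "measure samples E \<le> exp (- 2 * t\<^sup>2 / (\<Sum>i<n. (1 / real n)\<^sup>2))"
    unfolding E_def
    by (rule mcdiarmid[where B = 2]) (use t W_bd W_diff n_pos in \<open>auto intro: prob_space_axioms\<close>)
  ultimately have "measure samples E \<le> exp (- 2 * real n * t\<^sup>2)" by (simp add: mult_ac)
  then have "measure samples (space samples - E) \<ge> 1 - exp (- 2 * real n * t\<^sup>2)"
    by (simp add: S.prob_compl)
  moreover have "(\<integral>z. f z \<partial>P) \<le> (1 / real n) * (\<Sum>i<n. f (S i)) + 2 * rademacher_complexity n P F + t"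
    if "S \<in> space samples - E" "f \<in> F" for S f
    using W_upper[OF that(2), of S] W_exp that(1) by (auto simp: E_def)
  ultimately show ?thesis by (intro that[of "space samples - E"]) auto
qed

end

subsection \<open>Margin losses\<close>

text \<open>For a fixed sample, labels of modulus at most 1 make the loss \<open>L\<close>-Lipschitz
  in the value \<open>h x\<close>, so contraction applies with \<psi> equal to
  \<open>L * h x / n\<close>. The labels are then gone, and the remaining points are a sample from
  the marginal distribution.\<close>

lemma rademacher_complexity_margin_loss:
  fixes D :: "('x::topological_space \<times> real) measure" and H :: "('x \<Rightarrow> real) set"
  assumes D: "prob_space D" and fst_meas: "fst \<in> D \<rightarrow>\<^sub>M borel"
    and labels: "\<And>z. z \<in> space D \<Longrightarrow> \<bar>snd z\<bar> \<le> 1"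
    and H: "H \<noteq> {}" and Hb: "\<And>h x. h \<in> H \<Longrightarrow> \<bar>h x\<bar> \<le> c"
    and lip: "L-lipschitz_on UNIV \<phi>" and \<phi>b: "\<And>t. \<bar>\<phi> t\<bar> \<le> B"
    and meas: "measurable_suprema n D H"
  shows "rademacher_complexity n D (margin_loss_class \<phi> H)
           \<le> L * rademacher_complexity n (distr D borel fst) H"
proof -
  let ?Q = "distr D borel fst" and ?V = "sign_vectors {..<n}" and ?T = "compose {..<n} fst"
  interpret D: prob_space D by (rule D)
  interpret A: rademacher_class D n "margin_loss_class \<phi> H" B
    using H \<phi>b lip meas by unfold_locales (auto simp: margin_loss_class_def measurable_suprema_def)
  interpret Q: prob_space ?Q by (rule D.prob_space_distr[OF fst_meas])
  interpret X: rademacher_class ?Q n H c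
    using H Hb meas by unfold_locales (auto simp: measurable_suprema_def)
  have L: "L \<ge> 0" using lip by (rule lipschitz_on_nonneg)
  have c: "c \<ge> 0" using H Hb[THEN order_trans[OF abs_ge_zero]] by auto
  have B: "B \<ge> 0" using \<phi>b[THEN order_trans[OF abs_ge_zero]] by auto
  have T_meas[measurable]: "?T \<in> A.samples \<rightarrow>\<^sub>M X.samples"
  proof -
    have "(\<lambda>S. \<lambda>i\<in>{..<n}. fst (S i)) \<in> A.samples \<rightarrow>\<^sub>M X.samples"
      using fst_meas by (intro measurable_restrict) auto
    then show ?thesis by (simp add: compose_def[abs_def])
  qed
  \<comment> \<open>Dropping the labels pushes the product of copies of \<open>D\<close> forward to
    the product of the marginals.\<close>
  have T_distr: "distr A.samples X.samples ?T = X.samples"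
  proof -
    have "distr D ?Q fst = ?Q" by (rule distr_cong) auto
    then show ?thesis
      using fst_meas
      by (subst distr_PiM_finite_prob_space') (auto intro: D Q.prob_space_axioms)
  qed
  define G where "G S = (\<Sum>\<epsilon>\<in>?V. rademacher_sup n H (S, \<epsilon>)) / 2 ^ n" for S
  have G_int: "integrable X.samples G"
    unfolding G_def using X.integrable_rademacher_sup by auto
  have G_meas: "G \<in> borel_measurable X.samples" using G_int by auto
  have pointwise: "(\<Sum>\<epsilon>\<in>?V. rademacher_sup n (margin_loss_class \<phi> H) (S, \<epsilon>)) / 2 ^ n \<le> L * G (?T S)"
    if S: "S \<in> space A.samples" for S
  proof -
    define \<phi>' where "\<phi>' i h = (1 / real n) * \<phi> (snd (S i) * h (fst (S i)))" for i h
    define \<psi> where "\<psi> i h = (1 / real n) * (L * h (fst (S i)))" for i and h :: "'x \<Rightarrow> real"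
    \<comment> \<open>\<open>contraction\<close> asks for one bound on both families;
      \<open>B / n\<close> bounds \<phi>' and \<open>L * c / n\<close> bounds \<psi>.\<close>
    define C where "C = (1 / real n) * (B + L * c)"
    have "(\<Sum>\<epsilon>\<in>?V. rademacher_sup n (margin_loss_class \<phi> H) (S, \<epsilon>))
        = (\<Sum>\<epsilon>\<in>?V. SUP h\<in>H. 0 + (\<Sum>i<n. \<epsilon> i * \<phi>' i h))"
      by (simp add: rademacher_sup_def margin_loss_class_def image_image case_prod_unfold \<phi>'_def
        sum_distrib_left mult.left_commute sum_divide_distrib)
    also have "\<dots> \<le> (\<Sum>\<epsilon>\<in>?V. SUP h\<in>H. 0 + (\<Sum>i<n. \<epsilon> i * \<psi> i h))"
    proof (rule contraction[where B = 0 and C = C])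
      fix i g h assume i: "i \<in> {..<n}" and "g \<in> H" "h \<in> H"
      have y: "\<bar>snd (S i)\<bar> \<le> 1" using labels[of "S i"] S i by (auto simp: space_PiM)
      have "\<bar>\<phi> (snd (S i) * g (fst (S i))) - \<phi> (snd (S i) * h (fst (S i)))\<bar>
          \<le> L * \<bar>snd (S i) * (g (fst (S i)) - h (fst (S i)))\<bar>"
        using lipschitz_onD[OF lip, of "snd (S i) * g (fst (S i))" "snd (S i) * h (fst (S i))"]
        by (simp add: dist_real_def right_diff_distrib)
      also have "\<dots> \<le> L * (1 * \<bar>g (fst (S i)) - h (fst (S i))\<bar>)"
        unfolding abs_mult using y L by (intro mult_left_mono mult_right_mono) auto
      finally show "\<bar>\<phi>' i g - \<phi>' i h\<bar> \<le> \<bar>\<psi> i g - \<psi> i h\<bar>"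
        unfolding \<phi>'_def \<psi>_def right_diff_distrib[symmetric] abs_mult using L
        by (intro mult_left_mono) auto
    next
      fix i h assume "i \<in> {..<n}" and h: "h \<in> H"
      show "\<bar>\<phi>' i h\<bar> \<le> C"
        unfolding \<phi>'_def C_def abs_mult using \<phi>b L c
        by (intro mult_mono) (auto intro!: add_increasing2)
      show "\<bar>\<psi> i h\<bar> \<le> C"
        unfolding \<psi>_def C_def abs_mult using Hb[OF h] L B
        by (intro mult_mono) (auto intro!: add_increasing mult_left_mono)
    qed (use H in auto)
    also have "\<dots> \<le> (\<Sum>\<epsilon>\<in>?V. L * rademacher_sup n H (?T S, \<epsilon>))"
    proof (intro sum_mono cSUP_least H)
      fix \<epsilon> h assume \<epsilon>: "\<epsilon> \<in> ?V" and h: "h \<in> H"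
      have "0 + (\<Sum>i<n. \<epsilon> i * \<psi> i h) = L * ((1 / real n) * (\<Sum>i<n. \<epsilon> i * h (?T S i)))"
        by (simp add: \<psi>_def compose_def sum_distrib_left mult_ac sum_divide_distrib)
      also have "\<dots> \<le> L * rademacher_sup n H (?T S, \<epsilon>)"
        by (intro mult_left_mono X.rademacher_sup_upper h \<epsilon> L)
      finally show "0 + (\<Sum>i<n. \<epsilon> i * \<psi> i h) \<le> L * rademacher_sup n H (?T S, \<epsilon>)" .
    qed
    also have "\<dots> = L * G (?T S) * 2 ^ n"
      by (simp add: G_def sum_distrib_left)
    finally show ?thesis by (simp add: field_simps)
  qed
  have "rademacher_complexity n D (margin_loss_class \<phi> H) \<le> (\<integral>S. L * G (?T S) \<partial>A.samples)"
    unfolding A.rademacher_complexity_eq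
  proof (rule integral_mono)
    show "integrable A.samples (\<lambda>S. L * G (?T S))"
      using G_int integrable_distr_eq[OF T_meas G_meas] by (auto simp: T_distr)
  qed (use A.integrable_rademacher_sup pointwise in auto)
  also have "\<dots> = L * (\<integral>S. G S \<partial>distr A.samples X.samples ?T)"
    by (subst integral_distr[OF T_meas G_meas]) simp
  also have "\<dots> = L * rademacher_complexity n ?Q H"
    unfolding T_distr X.rademacher_complexity_eq G_def ..
  finally show ?thesis .
qed

text \<open>For \<gamma> > 0 this lies between the indicators of \<open>t \<le> 0\<close> and of
  \<open>t \<le> \<gamma>\<close>, and is linear in between.\<close>

definition ramp_loss :: "real \<Rightarrow> real \<Rightarrow> real" where
  "ramp_loss \<gamma> t = max 0 (min 1 (1 - t / \<gamma>))"

lemma ramp_loss_bounds: "0 \<le> ramp_loss \<gamma> t" "ramp_loss \<gamma> t \<le> 1"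
  by (auto simp: ramp_loss_def)

lemma ramp_loss_nonpos: "\<gamma> > 0 \<Longrightarrow> t \<le> 0 \<Longrightarrow> ramp_loss \<gamma> t = 1"
  by (simp add: ramp_loss_def divide_nonpos_pos)

lemma ramp_loss_ge: "\<gamma> > 0 \<Longrightarrow> \<gamma> \<le> t \<Longrightarrow> ramp_loss \<gamma> t = 0"
  by (simp add: ramp_loss_def)

lemma ramp_loss_le_linear: "\<gamma> > 0 \<Longrightarrow> t \<le> \<gamma> \<Longrightarrow> ramp_loss \<gamma> t \<le> 1 - t / \<gamma>"
  by (simp add: ramp_loss_def)

text \<open>Clipping to [0, 1] does not increase distances.\<close>

lemma ramp_loss_diff:
  assumes "\<gamma> > 0"
  shows "\<bar>ramp_loss \<gamma> s - ramp_loss \<gamma> t\<bar> \<le> (1 / \<gamma>) * \<bar>s - t\<bar>"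
proof -
  have "\<bar>ramp_loss \<gamma> s - ramp_loss \<gamma> t\<bar> \<le> \<bar>s / \<gamma> - t / \<gamma>\<bar>"
    by (auto simp: ramp_loss_def max_def min_def)
  also have "\<dots> = (1 / \<gamma>) * \<bar>s - t\<bar>"
    using assms by (simp add: diff_divide_distrib[symmetric])
  finally show ?thesis .
qed

definition mixed_loss :: "real \<Rightarrow> real \<Rightarrow> real \<Rightarrow> real \<Rightarrow> real" where
  "mixed_loss \<zeta> c \<gamma> t = \<zeta> * ramp_loss c t + (1 - \<zeta>) * ramp_loss \<gamma> t"

lemma mixed_loss_bounds:
  assumes "0 \<le> \<zeta>" "\<zeta> \<le> 1"
  shows "0 \<le> mixed_loss \<zeta> c \<gamma> t" "mixed_loss \<zeta> c \<gamma> t \<le> 1"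
  using assms ramp_loss_bounds convex_bound_le[of "ramp_loss c t" 1 "ramp_loss \<gamma> t" \<zeta> "1 - \<zeta>"]
  by (auto simp: mixed_loss_def)

lemma mixed_loss_lipschitz:
  assumes "0 \<le> \<zeta>" "\<zeta> \<le> 1" "0 < \<gamma>" "\<gamma> \<le> c"
  shows "(1 / \<gamma>)-lipschitz_on UNIV (mixed_loss \<zeta> c \<gamma>)"
proof (rule lipschitz_onI)
  fix s t :: real
  have 1: "\<bar>ramp_loss c s - ramp_loss c t\<bar> \<le> (1 / \<gamma>) * \<bar>s - t\<bar>"
  proof -
    have "\<bar>ramp_loss c s - ramp_loss c t\<bar> \<le> (1 / c) * \<bar>s - t\<bar>"
      using ramp_loss_diff assms by simp
    also have "\<dots> \<le> (1 / \<gamma>) * \<bar>s - t\<bar>"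
      using assms by (intro mult_right_mono frac_le) auto
    finally show ?thesis .
  qed
  have "\<bar>mixed_loss \<zeta> c \<gamma> s - mixed_loss \<zeta> c \<gamma> t\<bar>
      = \<bar>\<zeta> * (ramp_loss c s - ramp_loss c t) + (1 - \<zeta>) * (ramp_loss \<gamma> s - ramp_loss \<gamma> t)\<bar>"
    by (simp add: mixed_loss_def algebra_simps)
  also have "\<dots> \<le> \<zeta> * \<bar>ramp_loss c s - ramp_loss c t\<bar> + (1 - \<zeta>) * \<bar>ramp_loss \<gamma> s - ramp_loss \<gamma> t\<bar>"
    using assms by (intro order_trans[OF abs_triangle_ineq]) (simp add: abs_mult)
  also have "\<dots> \<le> (1 / \<gamma>) * \<bar>s - t\<bar>"
    by (rule convex_bound_le[OF 1 ramp_loss_diff]) (use assms in auto)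
  finally show "dist (mixed_loss \<zeta> c \<gamma> s) (mixed_loss \<zeta> c \<gamma> t) \<le> 1 / \<gamma> * dist s t"
    by (simp add: dist_real_def)
qed (use assms in auto)

section \<open>Dyadic scales and the cost of the union bound over them\<close>

lemma suminf_inverse_squares_le:
  "summable (\<lambda>j. 1 / (real (Suc j))\<^sup>2)"
  "(\<Sum>j. 1 / (real (Suc j))\<^sup>2) \<le> 2"
proof -
  show sm: "summable (\<lambda>j. 1 / (real (Suc j))\<^sup>2)"
    using inverse_power_summable[of 2, where 'a = real]
    by (subst summable_Suc_iff) (simp add: field_simps)
  \<comment> \<open>The subtracted term lets the induction telescope, since 1/(k+1)^2 is at most 1/k
    - 1/(k+1).\<close>
  have *: "(\<Sum>j<Suc m. 1 / (real (Suc j))\<^sup>2) \<le> 2 - 1 / real (Suc m)" for m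
  proof (induction m)
    case (Suc m)
    have "1 / (real (Suc (Suc m)))\<^sup>2 \<le> 1 / (real (Suc m) * real (Suc (Suc m)))"
      by (intro divide_left_mono) (auto simp: power2_eq_square intro!: mult_right_mono)
    also have "\<dots> = 1 / real (Suc m) - 1 / real (Suc (Suc m))"
      by (simp add: field_simps)
    finally show ?case using Suc.IH by simp
  qed simp
  have "(\<Sum>j<m. 1 / (real (Suc j))\<^sup>2) \<le> 2" for m
  proof (cases m)
    case (Suc k)
    have "0 \<le> 1 / real (Suc k)" by simp
    then show ?thesis using *[of k] unfolding Suc by linarith
  qed simp
  then show "(\<Sum>j. 1 / (real (Suc j))\<^sup>2) \<le> 2" by (rule suminf_le_const[OF sm])
qed

text \<open>With \<open>j\<close> the floor of \<open>log 2 (c / \<gamma>)\<close>, the ratio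
  \<open>c / \<gamma>\<close> lies between \<open>2 ^ j\<close> and \<open>2 ^ Suc j\<close>. Hence
  \<open>c / 2 ^ Suc j\<close> is at most \<gamma> and at least \<gamma>/2, and
  \<open>log 2 (4 * c / \<gamma>)\<close>, which exceeds \<open>log 2 (c / \<gamma>)\<close> by 2,
  covers the index \<open>Suc j\<close>.\<close>

lemma dyadic_scale:
  fixes c \<gamma> :: real
  assumes "0 < \<gamma>" "\<gamma> \<le> c"
  obtains j :: nat where "c / 2 ^ Suc j \<le> \<gamma>" "2 ^ Suc j / c \<le> 2 / \<gamma>" "real (Suc j) \<le> log 2 (4 * c / \<gamma>)"
proof -
  have c: "c > 0" and pos: "c / \<gamma> \<ge> 1" using assms by auto
  define j where "j = nat \<lfloor>log 2 (c / \<gamma>)\<rfloor>"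
  have "log 2 (c / \<gamma>) \<ge> 0" using pos by simp
  then have j: "real j \<le> log 2 (c / \<gamma>)" "log 2 (c / \<gamma>) < real j + 1"
    unfolding j_def by linarith+
  have le: "2 ^ j \<le> c / \<gamma>"
    using j(1) pos by (simp add: le_log_iff powr_realpow)
  have ge: "c / \<gamma> < 2 ^ Suc j"
    using j(2) pos by (simp add: log_less_iff powr_add powr_realpow)
  have "log 2 (4 * (c / \<gamma>)) = 2 + log 2 (c / \<gamma>)"
    using c assms log_pow_cancel[of 2 2] by (subst log_mult) auto
  with j have "real (Suc j) \<le> log 2 (4 * c / \<gamma>)" by simp
  moreover have "c / 2 ^ Suc j \<le> \<gamma>" using ge assms by (simp add: field_simps)
  moreover have "2 ^ Suc j / c \<le> 2 / \<gamma>" using le c assms by (simp add: field_simps)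
  ultimately show ?thesis using that by blast
qed

text \<open>The square of a sum of nonnegative numbers is at least the sum of the squares;
  multiplied by \<open>2 * real n\<close>, these are \<open>2 * ln k\<close> and
  \<open>ln (1 / \<delta>)\<close>.\<close>

lemma exp_peeling_bound:
  fixes \<delta> k :: real
  assumes "n > 0" "k \<ge> 1" "0 < \<delta>" "\<delta> < 1"
  shows "exp (- 2 * real n * (sqrt (ln k / real n) + sqrt (ln (1 / \<delta>) / (2 * real n)))\<^sup>2) \<le> \<delta> / k\<^sup>2"
proof -
  define a where "a = sqrt (ln k / real n)"
  define b where "b = sqrt (ln (1 / \<delta>) / (2 * real n))"
  have ab: "a \<ge> 0" "b \<ge> 0" "a\<^sup>2 = ln k / real n" "b\<^sup>2 = ln (1 / \<delta>) / (2 * real n)"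
    using assms by (auto simp: a_def b_def)
  have "a\<^sup>2 + b\<^sup>2 \<le> (a + b)\<^sup>2" using ab(1,2) by (simp add: power2_sum)
  then have "exp (- 2 * real n * (a + b)\<^sup>2) \<le> exp (- 2 * real n * (a\<^sup>2 + b\<^sup>2))"
    using assms by simp
  also have "- 2 * real n * (a\<^sup>2 + b\<^sup>2) = ln (\<delta> / k\<^sup>2)"
    using assms by (simp add: ab ln_div ln_realpow) (simp add: field_simps)
  also have "exp \<dots> = \<delta> / k\<^sup>2" using assms by simp
  finally show ?thesis by (simp add: a_def b_def)
qed

text \<open>A label in {-1, 1} that differs from \<open>sgn (h x)\<close> forces
  \<open>y * h x \<le> 0\<close>, also when \<open>h x = 0\<close>, and there \<phi> is 1.\<close>

lemma classification_error_le:
  assumes D: "prob_space D" and labels: "\<And>z. z \<in> space D \<Longrightarrow> snd z \<in> {-1, 1}"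
    and meas: "(\<lambda>(x, y). \<phi> (y * h x)) \<in> borel_measurable D"
    and \<phi>: "\<And>t. 0 \<le> \<phi> t" "\<And>t. \<phi> t \<le> 1" "\<And>t. t \<le> 0 \<Longrightarrow> \<phi> t = 1"
  shows "classification_error D h \<le> (\<integral>(x, y). \<phi> (y * h x) \<partial>D)"
  unfolding classification_error_def
\<comment> \<open>Without integrability the left integral would be 0 and still lie below the
  nonnegative right one, so integrability is checked for the majorant alone.\<close>
proof (rule integral_mono')
  interpret prob_space D by (rule D)
  show "integrable D (\<lambda>(x, y). \<phi> (y * h x))"
    using \<phi> meas by (intro integrable_const_bound[of _ 1]) (auto split: prod.split)
  fix z assume z: "z \<in> space D"
  obtain x y where [simp]: "z = (x, y)" by force
  have "\<phi> (y * h x) = 1" if "y \<noteq> sgn (h x)"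
    using that labels[OF z] by (intro \<phi>(3)) (auto simp: sgn_if split: if_splits)
  then show "(case z of (x, y) \<Rightarrow> of_bool (y \<noteq> sgn (h x))) \<le> (case z of (x, y) \<Rightarrow> \<phi> (y * h x))"
    using \<phi>(1) by simp
qed (use \<phi>(1) in auto)

text \<open>Margins are at most \<open>c\<close>, so the ramp at \<open>c\<close> lies below its
  linear piece, whose mean gives the average margin. The ramp at \<gamma>' vanishes from \<gamma>'
  on, in particular above \<gamma>, so the indicator counted by the margin error dominates
  it.\<close>

lemma empirical_mixed_loss_le:
  assumes n: "n > 0" and \<zeta>: "0 \<le> \<zeta>" "\<zeta> \<le> 1" and \<gamma>: "0 < \<gamma>'" "\<gamma>' \<le> \<gamma>" "0 < c"
    and bd: "\<And>i. i < n \<Longrightarrow> snd (S i) * h (fst (S i)) \<le> c"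
  shows "(1 / real n) * (\<Sum>i<n. mixed_loss \<zeta> c \<gamma>' (snd (S i) * h (fst (S i))))
    \<le> \<zeta> * (1 - average_margin n S h / c) + (1 - \<zeta>) * margin_error n S \<gamma> h"
proof -
  let ?m = "\<lambda>i. snd (S i) * h (fst (S i))"
  have "(\<Sum>i<n. mixed_loss \<zeta> c \<gamma>' (?m i))
      \<le> (\<Sum>i<n. \<zeta> * (1 - ?m i / c) + (1 - \<zeta>) * of_bool (?m i \<le> \<gamma>))"
    unfolding mixed_loss_def
  proof (intro sum_mono add_mono mult_left_mono)
    fix i assume "i \<in> {..<n}"
    then show "ramp_loss c (?m i) \<le> 1 - ?m i / c" using bd \<gamma> by (intro ramp_loss_le_linear) auto
    show "ramp_loss \<gamma>' (?m i) \<le> of_bool (?m i \<le> \<gamma>)"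
      using \<gamma> ramp_loss_bounds(2)[of \<gamma>' "?m i"] ramp_loss_ge[of \<gamma>' "?m i"] by auto
  qed (use \<zeta> in auto)
  also have "\<dots> = \<zeta> * (real n - (\<Sum>i<n. ?m i) / c) + (1 - \<zeta>) * real (card {i\<in>{..<n}. ?m i \<le> \<gamma>})"
  proof -
    have "{..<n} \<inter> {i. ?m i \<le> \<gamma>} = {i\<in>{..<n}. ?m i \<le> \<gamma>}" by auto
    then show ?thesis
      by (simp add: sum.distrib sum_distrib_left[symmetric] sum_subtractf sum_divide_distrib[symmetric])
  qed
  finally have "(1 / real n) * (\<Sum>i<n. mixed_loss \<zeta> c \<gamma>' (?m i))
      \<le> (1 / real n) * (\<zeta> * (real n - (\<Sum>i<n. ?m i) / c) + (1 - \<zeta>) * real (card {i\<in>{..<n}. ?m i \<le> \<gamma>}))"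
    by (intro mult_left_mono) auto
  also have "\<dots> = \<zeta> * (1 - average_margin n S h / c) + (1 - \<zeta>) * margin_error n S \<gamma> h"
    using n \<gamma> by (simp add: average_margin_def margin_error_def field_simps)
  finally show ?thesis .
qed

theorem theorem1:
  fixes D :: "((real ^ 'd) \<times> real) measure"
    and H :: "((real ^ 'd) \<Rightarrow> real) set"
    and n :: nat and c \<zeta> \<delta> :: real
  assumes "prob_space D"
    and "sets D = sets (borel \<Otimes>\<^sub>M count_space {-1, 1})"
    and "n \<ge> 1"
    and "c > 0"
    and "\<And>h. h \<in> H \<Longrightarrow> h \<in> borel_measurable borel"
    and "\<And>h x. h \<in> H \<Longrightarrow> \<bar>h x\<bar> \<le> c"
    and "measurable_suprema n D H"
    and "0 \<le> \<zeta>" and "\<zeta> \<le> 1"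
    and "0 < \<delta>" and "\<delta> < 1"
  shows "\<exists>A \<in> sets (PiM {..<n} (\<lambda>_. D)).
    measure (PiM {..<n} (\<lambda>_. D)) A \<ge> 1 - 2 * \<delta> \<and>
    (\<forall>S\<in>A. \<forall>\<gamma>\<in>{0<..c}. \<forall>h\<in>H.
       classification_error D h
         \<le> \<zeta> * (1 - average_margin n S h / c) + (1 - \<zeta>) * margin_error n S \<gamma> h
           + 4 * rademacher_complexity n (distr D borel fst) H / \<gamma>
           + sqrt (ln (log 2 (4 * c / \<gamma>)) / real n)
           + sqrt (ln (1 / \<delta>) / (2 * real n)))"
proof (cases "H = {}")
  \<comment> \<open>The claim is vacuous for an empty class, while the suprema are meaningful only
    for a nonempty one.\<close>
  case True
  interpret prob_space "PiM {..<n} (\<lambda>_. D)" by (intro prob_space_PiM assms(1))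
  show ?thesis
    using True prob_space assms(10) by (intro bexI[of _ "space (PiM {..<n} (\<lambda>_. D))"]) auto
next
  case False
  note \<zeta> = assms(8,9)
  let ?M = "PiM {..<n} (\<lambda>_. D)" and ?R = "rademacher_complexity n (distr D borel fst) H"
  interpret D: prob_space D by (rule assms(1))
  interpret S: prob_space ?M by (intro prob_space_PiM assms(1))
  have n: "n > 0" using assms(3) by simp
  have labels: "snd z \<in> {-1, 1}" if "z \<in> space D" for z
  proof -
    have "space D = UNIV \<times> {-1, 1}"
      unfolding sets_eq_imp_space_eq[OF assms(2)] by (simp add: space_pair_measure)
    with that show ?thesis by (metis mem_Times_iff)
  qed
  have fst_meas: "fst \<in> D \<rightarrow>\<^sub>M borel"
    by (subst measurable_cong_sets[OF assms(2) refl]) (rule measurable_fst)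
  have snd_meas: "snd \<in> borel_measurable D"
    by (subst measurable_cong_sets[OF assms(2) refl], rule measurable_compose[OF measurable_snd])
      (simp add: measurable_count_space_eq1)
  have margin_meas: "(\<lambda>(x, y). y * h x) \<in> borel_measurable D" if "h \<in> H" for h
    using borel_measurable_times[OF snd_meas measurable_compose[OF fst_meas assms(5)[OF that]]]
    by (simp add: case_prod_unfold)
  have R_nonneg: "?R \<ge> 0"
  proof -
    interpret Q: prob_space "distr D borel fst" by (rule D.prob_space_distr[OF fst_meas])
    interpret X: rademacher_class "distr D borel fst" n H c
      using False assms(6,7) by unfold_locales (auto simp: measurable_suprema_def)
    show ?thesis by (rule X.rademacher_complexity_nonneg)
  qed
  \<comment> \<open>Index \<open>j\<close> stands for the scale numbered \<open>Suc j\<close>, so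
    the coarsest scale is \<open>c / 2\<close> and the logarithm in \<open>s j\<close> is
    nonnegative.\<close>
  define \<phi> where "\<phi> j = mixed_loss \<zeta> c (c / 2 ^ Suc j)" for j
  define s where "s j = sqrt (ln (real (Suc j)) / real n) + sqrt (ln (1 / \<delta>) / (2 * real n))" for j
  have lip: "(2 ^ Suc j / c)-lipschitz_on UNIV (\<phi> j)" for j
  proof -
    have "c / 2 ^ Suc j \<le> c / 1"
      using assms(4) one_le_power[of "2 :: real" "Suc j"] by (intro divide_left_mono) auto
    then show ?thesis
      using mixed_loss_lipschitz[OF \<zeta>, of "c / 2 ^ Suc j" c] assms(4) by (simp add: \<phi>_def)
  qed
  have \<phi>_bounds: "0 \<le> \<phi> j t" "\<phi> j t \<le> 1" for j t
    unfolding \<phi>_def using mixed_loss_bounds[OF \<zeta>] by auto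
  have \<phi>_nonpos: "\<phi> j t = 1" if "t \<le> 0" for j t
    using that assms(4) by (simp add: \<phi>_def mixed_loss_def ramp_loss_nonpos)
  have loss_meas: "(\<lambda>(x, y). \<phi> j (y * h x)) \<in> borel_measurable D" if "h \<in> H" for j h
  proof -
    have "\<phi> j \<in> borel_measurable borel"
      by (intro borel_measurable_continuous_onI lipschitz_on_continuous_on[OF lip])
    from measurable_compose[OF margin_meas[OF that] this] show ?thesis by (simp add: case_prod_unfold)
  qed
  \<comment> \<open>The event for one scale is chosen before \<gamma> and \<open>h\<close>, so a
    single countable intersection serves all of them.\<close>
  define good where "good j A \<longleftrightarrow> A \<in> sets ?M \<and> measure ?M A \<ge> 1 - \<delta> / (real (Suc j))\<^sup>2 \<and>
      (\<forall>S\<in>A. \<forall>h\<in>H. (\<integral>(x, y). \<phi> j (y * h x) \<partial>D)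
        \<le> (1 / real n) * (\<Sum>i<n. \<phi> j (snd (S i) * h (fst (S i))))
          + 2 * rademacher_complexity n D (margin_loss_class (\<phi> j) H) + s j)" for j A
  have "\<exists>A. good j A" for j
  proof -
    have "rademacher_sup n (margin_loss_class (\<phi> j) H) \<in> borel_measurable (?M \<Otimes>\<^sub>M rademacher_signs n)"
      using assms(7) lip[of j] unfolding measurable_suprema_def by blast
    then interpret L: unit_rademacher_class D n "margin_loss_class (\<phi> j) H"
      using False \<phi>_bounds loss_meas n by unfold_locales (auto simp: margin_loss_class_def)
    have "s j \<ge> 0" using n assms(10,11) by (auto simp: s_def)
    then obtain A where A: "A \<in> sets ?M" "measure ?M A \<ge> 1 - exp (- 2 * real n * (s j)\<^sup>2)"
      "\<And>S f. S \<in> A \<Longrightarrow> f \<in> margin_loss_class (\<phi> j) H \<Longrightarrow> (\<integral>z. f z \<partial>D) \<le> (1 / real n) * (\<Sum>i<n. f (S i))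
          + 2 * rademacher_complexity n D (margin_loss_class (\<phi> j) H) + s j"
      by (rule L.uniform_deviation) blast
    have "exp (- 2 * real n * (s j)\<^sup>2) \<le> \<delta> / (real (Suc j))\<^sup>2"
      unfolding s_def using n assms(10,11) by (intro exp_peeling_bound) auto
    then have "measure ?M A \<ge> 1 - \<delta> / (real (Suc j))\<^sup>2" using A(2) by linarith
    moreover have "(\<integral>(x, y). \<phi> j (y * h x) \<partial>D)
        \<le> (1 / real n) * (\<Sum>i<n. \<phi> j (snd (S i) * h (fst (S i))))
          + 2 * rademacher_complexity n D (margin_loss_class (\<phi> j) H) + s j"
      if "S \<in> A" "h \<in> H" for S h
      using A(3)[OF that(1), of "\<lambda>(x, y). \<phi> j (y * h x)"] that(2)
      by (auto simp: margin_loss_class_def case_prod_unfold)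
    ultimately show ?thesis using A(1) unfolding good_def by blast
  qed
  then obtain A where good: "\<And>j. good j (A j)" by metis
  have A: "A j \<in> sets ?M" "measure ?M (A j) \<ge> 1 - \<delta> / (real (Suc j))\<^sup>2" for j
    using good[of j] by (auto simp only: good_def)
  have dev: "(\<integral>(x, y). \<phi> j (y * h x) \<partial>D)
        \<le> (1 / real n) * (\<Sum>i<n. \<phi> j (snd (S i) * h (fst (S i))))
          + 2 * rademacher_complexity n D (margin_loss_class (\<phi> j) H) + s j"
    if "S \<in> A j" "h \<in> H" for j S h
    using good[of j] that unfolding good_def by blast
  define G where "G = (\<Inter>j. A j)"
  have G_sets: "G \<in> sets ?M" using A(1) by (auto simp: G_def)
  have "measure ?M G \<ge> 1 - 2 * \<delta>"
  proof -
    \<comment> \<open>Union bound over the complements: the failure probabilities \<delta>/k^2 sum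
      to at most 2 \<delta>.\<close>
    have c: "measure ?M (space ?M - A j) \<le> \<delta> * (1 / (real (Suc j))\<^sup>2)" for j
      using A(2)[of j] by (simp add: S.prob_compl[OF A(1)])
    have sm: "summable (\<lambda>j. \<delta> * (1 / (real (Suc j))\<^sup>2))"
      by (intro summable_mult suminf_inverse_squares_le)
    have sm': "summable (\<lambda>j. measure ?M (space ?M - A j))"
      by (rule summable_comparison_test'[OF sm]) (use c in auto)
    have "measure ?M (space ?M - G) = measure ?M (\<Union>j. space ?M - A j)"
      by (auto simp: G_def intro!: arg_cong[where f = "measure ?M"])
    also have "\<dots> \<le> (\<Sum>j. measure ?M (space ?M - A j))"
      using A(1) sm' by (intro S.finite_measure_subadditive_countably) auto
    also have "\<dots> \<le> (\<Sum>j. \<delta> * (1 / (real (Suc j))\<^sup>2))"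
      by (intro suminf_le c sm sm')
    also have "\<dots> = \<delta> * (\<Sum>j. 1 / (real (Suc j))\<^sup>2)"
      by (intro suminf_mult suminf_inverse_squares_le)
    also have "\<dots> \<le> \<delta> * 2"
      using assms(10) by (intro mult_left_mono suminf_inverse_squares_le) auto
    finally show ?thesis by (simp add: S.prob_compl[OF G_sets])
  qed
  moreover have "classification_error D h
         \<le> \<zeta> * (1 - average_margin n S h / c) + (1 - \<zeta>) * margin_error n S \<gamma> h
           + 4 * ?R / \<gamma> + sqrt (ln (log 2 (4 * c / \<gamma>)) / real n)
           + sqrt (ln (1 / \<delta>) / (2 * real n))"
    if S: "S \<in> G" and \<gamma>: "\<gamma> \<in> {0<..c}" and h: "h \<in> H" for S \<gamma> h
  proof -
    obtain j where j: "c / 2 ^ Suc j \<le> \<gamma>" "2 ^ Suc j / c \<le> 2 / \<gamma>"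
      "real (Suc j) \<le> log 2 (4 * c / \<gamma>)"
      using \<gamma> by (auto intro: dyadic_scale[of \<gamma> c])
    have "S \<in> space ?M" using S sets.sets_into_space[OF G_sets] by auto
    then have Si: "S i \<in> space D" if "i < n" for i using that by (auto simp: space_PiM)
    have bd: "snd (S i) * h (fst (S i)) \<le> c" if "i < n" for i
      using labels[OF Si[OF that]] assms(6)[OF h, of "fst (S i)"] by (auto simp: abs_le_iff)
    have "classification_error D h \<le> (\<integral>(x, y). \<phi> j (y * h x) \<partial>D)"
      by (rule classification_error_le[OF assms(1) labels loss_meas[OF h]])
        (use \<phi>_bounds \<phi>_nonpos in auto)
    moreover have "\<dots> \<le> (1 / real n) * (\<Sum>i<n. \<phi> j (snd (S i) * h (fst (S i))))
          + 2 * rademacher_complexity n D (margin_loss_class (\<phi> j) H) + s j"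
      using S h by (intro dev) (auto simp: G_def)
    moreover have "(1 / real n) * (\<Sum>i<n. \<phi> j (snd (S i) * h (fst (S i))))
        \<le> \<zeta> * (1 - average_margin n S h / c) + (1 - \<zeta>) * margin_error n S \<gamma> h"
      unfolding \<phi>_def by (rule empirical_mixed_loss_le[OF n \<zeta>]) (use assms(4) j(1) bd in auto)
    \<comment> \<open>The 4 is a factor 2 from symmetrization times a factor 2 from rounding
      \<gamma> down; the second needs the complexity of \<open>H\<close> to be nonnegative.\<close>
    moreover have "2 * rademacher_complexity n D (margin_loss_class (\<phi> j) H) \<le> 4 * ?R / \<gamma>"
    proof -
      have "rademacher_complexity n D (margin_loss_class (\<phi> j) H) \<le> 2 ^ Suc j / c * ?R"
      proof (rule rademacher_complexity_margin_loss[OF assms(1) fst_meas, where c = c and B = 1])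
        show "\<bar>snd z\<bar> \<le> 1" if "z \<in> space D" for z using labels[OF that] by auto
        show "\<bar>\<phi> j t\<bar> \<le> 1" for t using \<phi>_bounds[of j t] by simp
      qed (rule False lip assms(7) | erule assms(6))+
      also have "\<dots> \<le> 2 / \<gamma> * ?R" by (rule mult_right_mono[OF j(2) R_nonneg])
      finally show ?thesis by simp
    qed
    moreover have "s j \<le> sqrt (ln (log 2 (4 * c / \<gamma>)) / real n) + sqrt (ln (1 / \<delta>) / (2 * real n))"
      unfolding s_def using j(3) n
      by (intro add_right_mono real_sqrt_le_mono divide_right_mono ln_mono) auto
    ultimately show ?thesis by linarith
  qed
  ultimately show ?thesis using G_sets by blast
qed

end
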